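(* Let $(\mathcal W,S)$ be an irreducible Coxeter system with $S$ finite, and let $c\in\mathcal W$ be a Coxeter element. Let $s\in S$ and let $x$ be the unique vertex of $\Gamma$ with $s=\rho(x)$. (a) The root $\pi_s(c)=\rho\left(W_{1,x}^T\right)(-\alpha_s)$ is $c$-projective with $W_{\pi_s(c)}=W_{1,x}$. The map $S\to\mathcal P(c,1)$ given by $s\mapsto\pi_s(c)$ is bijective, so that $\mathcal P(c,1)=\{\pi_s(c)\mid s\in S\}$. (b) Let $t=\rho(y)\in S$, $y\in\Gamma_0$. If $x\not\le y$, the $t$-coordinate of $\pi_s(c)$ is $0$. If $x\le y$, the $t$-coordinate of $\pi_s(c)$ is $\sum_p B(p)$, where $p$ runs through all paths from $x$ to $y$ in $(\Gamma,c)$. Hence $$\pi_s(c)=\sum_{y\in\Gamma_0,\ x\le y}\Big(\sum_{p:x\to y}B(p)\Big)\alpha_{\rho(y)}.$$ (c) $\pi_s(c)=-c^{-1}\pi_s(c^{-1})$ and $\pi_s(c^{-1})=-c\,\pi_s(c)$. Therefore the linear operators $-c$ and $-c^{-1}$ on $\mathbb V$ induce mutually inverse bijections $-c:\mathcal P(c,1)\to\mathcal P(c^{-1},1)$ and $-c^{-1}:\mathcal P(c^{-1},1)\to\mathcal P(c,1)$.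
   Context: Coxeter setting. $(\mathcal W,S)$ has Coxeter matrix $(m(s,s'))_{s,s'\in S}$. Its Coxeter graph $\Gamma$ has vertex set $\Gamma_0$ with a fixed bijection $\rho:\Gamma_0\to S$; distinct vertices $x,y$ are joined by an edge (exactly one) iff $2<m(\rho(x),\rho(y))\le\infty$; irreducible means that $\Gamma$ is connected. Graph monoid. $\mathfrak M$ is the quotient of the free monoid on $\Gamma_0$ by the congruence generated by $vw\sim wv$ for all distinct $v,w\in\Gamma_0$ not joined by an edge. Its elements are written as words $X=x_l\cdots x_1$ ($x_j\in\Gamma_0$, $l\ge 0$); $\mathrm{Supp}\,X=\{x_1,\dots,x_l\}$; $X$ is multiplicity-free if the $x_j$ are pairwise distinct; $X^T=x_1\cdots x_l$. The letter $\rho$ also denotes the induced monoid homomorphism $\mathfrak M\to\mathcal W$. Partial order on $\mathfrak M$: $Y\preceq X$ iff $X=UY$ for some $U\in\mathfrak M$. Roots. $\mathbb V$ is the real vector space with basis $\{\alpha_s\mid s\in S\}$ and symmetric bilinear form $B(\alpha_s,\alpha_{s'})=-2\cos\frac{\pi}{m(s,s')}$ (with $\frac{\pi}{\infty}=0$); the coefficient of $\alpha_t$ in a vector is its $t$-coordinate. $\mathcal W$ acts on $\mathbb V$ by $s\lambda=\lambda-B(\alpha_s,\lambda)\alpha_s$. The roots are the vectors $w(\alpha_s)$, $w\in\mathcal W$, $s\in S$. A root is positive ($>0$), resp. negative ($<0$), if all its coordinates are $\ge 0$, resp. $\le 0$. Coxeter element and admissible words. $c=s_n\cdots s_1$, where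 $s_1,\dots,s_n$ are all the elements of $S$ in some order, and $v_j=\rho^{-1}(s_j)$. The $c$-orientation of $\Gamma$ directs each edge between $v_i$ and $v_j$ with $j>i$ as $v_j\to v_i$ (it depends only on the element $c$); $(\Gamma,c)$ denotes the resulting acyclic quiver. A sink is a vertex at which no arrow starts. A word $X=x_l\cdots x_1$ is $c$-admissible if $x_1$ is a sink for the $c$-orientation and, for $1<j\le l$, $x_j$ is a sink for the orientation obtained from the $c$-orientation by reversing all arrows incident to $x_1$, then all arrows incident to $x_2$, and so on up to $x_{j-1}$. This is well defined on elements of $\mathfrak M$; $\mathfrak M(c)\subset\mathfrak M$ is the set of $c$-admissible elements. $\Gamma_0$ is a poset: $x\le y$ iff there is a directed path (possibly trivial) from $x$ to $y$ in $(\Gamma,c)$; $\langle x\rangle=\{y\mid y\ge x\}$. All notions apply to every Coxeter element, in particular to $c^{-1}=s_1\cdots s_n$. $W_{1,x}$ is the unique multiplicity-free $c$-admissible element of $\mathfrak M$ with support $\langle x\rangle$. The root $\pi_s(c^{-1})$ is defined as $\pi_s(c)$ is, with $c$ replaced by $c^{-1}$ (including in the definition of $W_{1,x}$). A root $\alpha>0$ is $c$-preprojective (resp. $c$-projective) if $\rho(X)\alpha<0$ for some $X\in\mathfrak M(c)$ (resp. multiplicity-free $X\in\mathfrak M(c)$). For a $c$-preprojective $\alpha$, the set $\{X\in\mathfrak M(c)\mid\rho(X)\alpha<0\}$ has a unique $\preceq$-least element, denoted $W_\alpha$. $\mathcal P(c,1)$ is the set of $c$-projective roots. Values of $B$ on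 paths. For a trivial path $e_x$ at a vertex $x$, $B(e_x)=1$. For a nontrivial path $p=a_t\cdots a_1$ (arrows $a_j:s(a_j)\to e(a_j)$ with $e(a_j)=s(a_{j+1})$), $B(p)=(-1)^t\prod_{j=1}^t B\left(\alpha_{\rho(e(a_j))},\alpha_{\rho(s(a_j))}\right)$. *)

theory Defs
  imports Complex_Main "HOL-Library.Extended_Nat" "HOL-Algebra.Group"
begin

text \<open>A word \<open>x\<^sub>l \<dots> x\<^sub>1\<close> is the list \<open>[x\<^sub>l, \<dots>, x\<^sub>1]\<close>, so that products of words are
  concatenations and the letter \<open>x\<^sub>1\<close>, which acts first, is the last entry of the list.\<close>

inductive_set word_cong :: "'a set \<Rightarrow> ('a list \<times> 'a list) set \<Rightarrow> ('a list \<times> 'a list) set"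
  for A :: "'a set" and R :: "('a list \<times> 'a list) set" where
  base: "(u, v) \<in> R \<Longrightarrow> u \<in> lists A \<Longrightarrow> v \<in> lists A \<Longrightarrow> (u, v) \<in> word_cong A R"
| refl: "u \<in> lists A \<Longrightarrow> (u, u) \<in> word_cong A R"
| sym: "(u, v) \<in> word_cong A R \<Longrightarrow> (v, u) \<in> word_cong A R"
| trans: "(u, v) \<in> word_cong A R \<Longrightarrow> (v, w) \<in> word_cong A R \<Longrightarrow> (u, w) \<in> word_cong A R"
| mult: "(u, v) \<in> word_cong A R \<Longrightarrow> a \<in> lists A \<Longrightarrow> b \<in> lists A \<Longrightarrow>
    (a @ u @ b, a @ v @ b) \<in> word_cong A R"

definition word_prod :: "('a, 'b) monoid_scheme \<Rightarrow> 'a list \<Rightarrow> 'a" where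
  "word_prod G ss = foldr (\<lambda>a b. a \<otimes>\<^bsub>G\<^esub> b) ss \<one>\<^bsub>G\<^esub>"

text \<open>The group is the underlying monoid record; \<open>gens\<close> is the set \<open>S\<close>, and
  \<open>rho\<close> labels the vertices of the Coxeter graph by the generators.\<close>

record ('w, 'v) coxeter_data = "'w monoid" +
  gens :: "'w set"
  cox_mat :: "'w \<Rightarrow> 'w \<Rightarrow> enat"
  verts :: "'v set"
  rho :: "'v \<Rightarrow> 'w"

definition coxeter_matrix :: "'w set \<Rightarrow> ('w \<Rightarrow> 'w \<Rightarrow> enat) \<Rightarrow> bool" where
  "coxeter_matrix S m \<longleftrightarrow>
     (\<forall>s\<in>S. m s s = 1) \<and> (\<forall>s\<in>S. \<forall>t\<in>S. s \<noteq> t \<longrightarrow> 2 \<le> m s t \<and> m s t = m t s)"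

definition coxeter_relations :: "'w set \<Rightarrow> ('w \<Rightarrow> 'w \<Rightarrow> enat) \<Rightarrow> ('w list \<times> 'w list) set" where
  "coxeter_relations S m =
     {(concat (replicate k [s, t]), []) | s t k. s \<in> S \<and> t \<in> S \<and> m s t = enat k}"

text \<open>The last two conditions say that \<open>W\<close> is presented by the generators \<open>S\<close> and the relations
  \<open>(s t) ^ m(s,t) = 1\<close> for finite \<open>m(s,t)\<close>. As these include \<open>s s = 1\<close>, the monoid presented in
  this way is already the group with that presentation.\<close>

definition coxeter_system :: "('w, 'v) coxeter_data \<Rightarrow> bool" where
  "coxeter_system W \<longleftrightarrow> group W \<and> gens W \<subseteq> carrier W \<and> coxeter_matrix (gens W) (cox_mat W) \<and>
     (\<forall>w\<in>carrier W. \<exists>ss\<in>lists (gens W). word_prod W ss = w) \<and>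
     (\<forall>u\<in>lists (gens W). \<forall>v\<in>lists (gens W). word_prod W u = word_prod W v \<longleftrightarrow>
        (u, v) \<in> word_cong (gens W) (coxeter_relations (gens W) (cox_mat W)))"

definition edges :: "('w, 'v) coxeter_data \<Rightarrow> ('v \<times> 'v) set" where
  "edges W = {(x, y). x \<in> verts W \<and> y \<in> verts W \<and> x \<noteq> y \<and> 2 < cox_mat W (rho W x) (rho W y)}"

definition irreducible_graph :: "('w, 'v) coxeter_data \<Rightarrow> bool" where
  "irreducible_graph W \<longleftrightarrow> (\<forall>x\<in>verts W. \<forall>y\<in>verts W. (x, y) \<in> (edges W)\<^sup>*)"

definition graph_cong :: "('w, 'v) coxeter_data \<Rightarrow> ('v list \<times> 'v list) set" where
  "graph_cong W = word_cong (verts W)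
     {([v, w], [w, v]) | v w. v \<in> verts W \<and> w \<in> verts W \<and> v \<noteq> w \<and> (v, w) \<notin> edges W}"

definition word_class :: "('w, 'v) coxeter_data \<Rightarrow> 'v list \<Rightarrow> 'v list set" where
  "word_class W u = graph_cong W `` {u}"

definition graph_monoid :: "('w, 'v) coxeter_data \<Rightarrow> 'v list set monoid" where
  "graph_monoid W = \<lparr>carrier = lists (verts W) // graph_cong W,
     mult = (\<lambda>X Y. \<Union>u\<in>X. \<Union>v\<in>Y. word_class W (u @ v)),
     one = word_class W []\<rparr>"

text \<open>Support, multiplicity-freeness, transposition and evaluation in \<open>W\<close> are invariant under the
  commutation relations, so the following do not depend on the representing words.\<close>

definition Supp :: "'v list set \<Rightarrow> 'v set" where
  "Supp X = (\<Union>u\<in>X. set u)"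

definition mult_free :: "'v list set \<Rightarrow> bool" where
  "mult_free X \<longleftrightarrow> (\<forall>u\<in>X. distinct u)"

definition word_transp :: "'v list set \<Rightarrow> 'v list set" where
  "word_transp X = rev ` X"

definition rho_monoid :: "('w, 'v) coxeter_data \<Rightarrow> 'v list set \<Rightarrow> 'w" where
  "rho_monoid W X = the_elem ((\<lambda>u. word_prod W (map (rho W) u)) ` X)"

definition preceq :: "('w, 'v) coxeter_data \<Rightarrow> 'v list set \<Rightarrow> 'v list set \<Rightarrow> bool" where
  "preceq W Y X \<longleftrightarrow> (\<exists>U\<in>carrier (graph_monoid W). X = U \<otimes>\<^bsub>graph_monoid W\<^esub> Y)"

text \<open>A vector of the space with basis indexed by \<open>S\<close> is the function giving its coordinates,
  extended by \<open>0\<close> outside \<open>S\<close>.\<close>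

definition alpha :: "'w \<Rightarrow> 'w \<Rightarrow> real" where
  "alpha s = (\<lambda>t. if t = s then 1 else 0)"

fun pi_over :: "enat \<Rightarrow> real" where
  "pi_over (enat k) = pi / real k"
| "pi_over \<infinity> = 0"

definition bform :: "('w, 'v) coxeter_data \<Rightarrow> ('w \<Rightarrow> real) \<Rightarrow> ('w \<Rightarrow> real) \<Rightarrow> real" where
  "bform W u v =
     (\<Sum>s\<in>gens W. \<Sum>t\<in>gens W. u s * v t * (- 2 * cos (pi_over (cox_mat W s t))))"

definition reflection :: "('w, 'v) coxeter_data \<Rightarrow> 'w \<Rightarrow> ('w \<Rightarrow> real) \<Rightarrow> ('w \<Rightarrow> real)" where
  "reflection W s v = (\<lambda>t. v t - bform W (alpha s) v * alpha s t)"

text \<open>An element of the group acts through any word representing it; the resulting operator does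
  not depend on the word, because the reflections satisfy the defining relations of \<open>W\<close>.\<close>

definition act :: "('w, 'v) coxeter_data \<Rightarrow> 'w \<Rightarrow> ('w \<Rightarrow> real) \<Rightarrow> ('w \<Rightarrow> real)" where
  "act W w = foldr (reflection W) (SOME ss. ss \<in> lists (gens W) \<and> word_prod W ss = w)"

definition roots :: "('w, 'v) coxeter_data \<Rightarrow> ('w \<Rightarrow> real) set" where
  "roots W = {act W w (alpha s) | w s. w \<in> carrier W \<and> s \<in> gens W}"

definition pos_root :: "('w, 'v) coxeter_data \<Rightarrow> ('w \<Rightarrow> real) \<Rightarrow> bool" where
  "pos_root W v \<longleftrightarrow> v \<in> roots W \<and> (\<forall>t\<in>gens W. 0 \<le> v t)"

definition neg_root :: "('w, 'v) coxeter_data \<Rightarrow> ('w \<Rightarrow> real) \<Rightarrow> bool" where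
  "neg_root W v \<longleftrightarrow> v \<in> roots W \<and> (\<forall>t\<in>gens W. v t \<le> 0)"

definition cox_ordering :: "('w, 'v) coxeter_data \<Rightarrow> 'w \<Rightarrow> 'w list \<Rightarrow> bool" where
  "cox_ordering W c ss \<longleftrightarrow> distinct ss \<and> set ss = gens W \<and> word_prod W ss = c"

definition coxeter_element :: "('w, 'v) coxeter_data \<Rightarrow> 'w \<Rightarrow> bool" where
  "coxeter_element W c \<longleftrightarrow> (\<exists>ss. cox_ordering W c ss)"

text \<open>With \<open>c = s\<^sub>n \<dots> s\<^sub>1\<close>, an edge is directed from its vertex of larger index, which stands further
  left in the list \<open>ss\<close>, to the other one. All orderings of \<open>S\<close> with product \<open>c\<close> give the same
  orientation.\<close>

definition arrows :: "('w, 'v) coxeter_data \<Rightarrow> 'w \<Rightarrow> ('v \<times> 'v) set" where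
  "arrows W c = {(x, y) \<in> edges W. \<exists>ss i j. cox_ordering W c ss \<and>
     i < j \<and> j < length ss \<and> ss ! i = rho W x \<and> ss ! j = rho W y}"

definition sink :: "('v \<times> 'v) set \<Rightarrow> 'v \<Rightarrow> bool" where
  "sink R x \<longleftrightarrow> (\<forall>y. (x, y) \<notin> R)"

definition reverse_at :: "'v \<Rightarrow> ('v \<times> 'v) set \<Rightarrow> ('v \<times> 'v) set" where
  "reverse_at x R = {(u, v) \<in> R. u \<noteq> x \<and> v \<noteq> x} \<union> {(v, u) | u v. (u, v) \<in> R \<and> (u = x \<or> v = x)}"

text \<open>Unlike in words, the letters are listed here in the order \<open>x\<^sub>1, \<dots>, x\<^sub>l\<close>.\<close>

fun sink_sequence :: "('v \<times> 'v) set \<Rightarrow> 'v list \<Rightarrow> bool" where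
  "sink_sequence R [] \<longleftrightarrow> True"
| "sink_sequence R (x # xs) \<longleftrightarrow> sink R x \<and> sink_sequence (reverse_at x R) xs"

definition admissible_word :: "('w, 'v) coxeter_data \<Rightarrow> 'w \<Rightarrow> 'v list \<Rightarrow> bool" where
  "admissible_word W c u \<longleftrightarrow> u \<in> lists (verts W) \<and> sink_sequence (arrows W c) (rev u)"

definition admissible :: "('w, 'v) coxeter_data \<Rightarrow> 'w \<Rightarrow> 'v list set set" where
  "admissible W c = word_class W ` {u. admissible_word W c u}"

definition vertex_le :: "('w, 'v) coxeter_data \<Rightarrow> 'w \<Rightarrow> 'v \<Rightarrow> 'v \<Rightarrow> bool" where
  "vertex_le W c x y \<longleftrightarrow> x \<in> verts W \<and> y \<in> verts W \<and> (x, y) \<in> (arrows W c)\<^sup>*"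

definition up_set :: "('w, 'v) coxeter_data \<Rightarrow> 'w \<Rightarrow> 'v \<Rightarrow> 'v set" where
  "up_set W c x = {y. vertex_le W c x y}"

definition W1 :: "('w, 'v) coxeter_data \<Rightarrow> 'w \<Rightarrow> 'v \<Rightarrow> 'v list set" where
  "W1 W c x = (THE X. X \<in> admissible W c \<and> mult_free X \<and> Supp X = up_set W c x)"

definition pi_root :: "('w, 'v) coxeter_data \<Rightarrow> 'w \<Rightarrow> 'w \<Rightarrow> ('w \<Rightarrow> real)" where
  "pi_root W c s =
     act W (rho_monoid W (word_transp (W1 W c (the_inv_into (verts W) (rho W) s)))) (- alpha s)"

definition projective :: "('w, 'v) coxeter_data \<Rightarrow> 'w \<Rightarrow> ('w \<Rightarrow> real) \<Rightarrow> bool" where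
  "projective W c a \<longleftrightarrow> pos_root W a \<and>
     (\<exists>X\<in>admissible W c. mult_free X \<and> neg_root W (act W (rho_monoid W X) a))"

definition negating :: "('w, 'v) coxeter_data \<Rightarrow> 'w \<Rightarrow> ('w \<Rightarrow> real) \<Rightarrow> 'v list set set" where
  "negating W c a = {X \<in> admissible W c. neg_root W (act W (rho_monoid W X) a)}"

definition W_root :: "('w, 'v) coxeter_data \<Rightarrow> 'w \<Rightarrow> ('w \<Rightarrow> real) \<Rightarrow> 'v list set" where
  "W_root W c a = (THE X. X \<in> negating W c a \<and> (\<forall>Y\<in>negating W c a. preceq W X Y))"

definition proj_roots :: "('w, 'v) coxeter_data \<Rightarrow> 'w \<Rightarrow> ('w \<Rightarrow> real) set" where
  "proj_roots W c = {a. projective W c a}"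

text \<open>A path \<open>a\<^sub>t \<dots> a\<^sub>1\<close> from \<open>x\<close> to \<open>y\<close> is the list \<open>[a\<^sub>1, \<dots>, a\<^sub>t]\<close> of its arrows in order of traversal,
  an arrow being the pair of its start and its end; \<open>[]\<close> is the trivial path at \<open>x = y\<close>.\<close>

fun is_path :: "('v \<times> 'v) set \<Rightarrow> 'v \<Rightarrow> ('v \<times> 'v) list \<Rightarrow> 'v \<Rightarrow> bool" where
  "is_path R x [] y \<longleftrightarrow> x = y"
| "is_path R x (a # p) y \<longleftrightarrow> a \<in> R \<and> fst a = x \<and> is_path R (snd a) p y"

definition paths :: "('w, 'v) coxeter_data \<Rightarrow> 'w \<Rightarrow> 'v \<Rightarrow> 'v \<Rightarrow> ('v \<times> 'v) list set" where
  "paths W c x y = {p. is_path (arrows W c) x p y}"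

definition path_value :: "('w, 'v) coxeter_data \<Rightarrow> ('v \<times> 'v) list \<Rightarrow> real" where
  "path_value W p = (- 1) ^ length p *
     prod_list (map (\<lambda>a. bform W (alpha (rho W (snd a))) (alpha (rho W (fst a)))) p)"

end

theory Submission
  imports Defs "HOL-Library.Multiset"
begin

text \<open>Let \<open>z\<^sub>1, \<dots>, z\<^sub>k = x\<close> be a repetition-free admissible sequence, and apply to the simple root at
  \<open>x\<close> the reflections \<open>z\<^sub>k\<^sub>-\<^sub>1, \<dots>, z\<^sub>1\<close> in this order. Each reflection changes only its own coordinate, to
  a weighted sum over the incoming arrows of coordinates already computed, which is the recursion
  satisfied by the path sums. So the resulting vector depends on \<open>x\<close> only, which gives (b); choosing
  the letters to the right of \<open>x\<close> in an ordering of \<open>S\<close> that defines \<open>c\<close>, respectively the letters to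
  its left for the inverse of \<open>c\<close>, gives (c). The \<open>x\<close>-coordinate of the vector is \<open>1\<close>, so an admissible
  word negating it must contain \<open>x\<close>, and then the word of \<open>x\<close> can be moved to its right end.
  Conversely, when a projective root first turns negative it is a simple root just before that step,
  because roots have constant sign.\<close>

section \<open>The geometric representation\<close>

text \<open>The definitions contain choices that have to be removed before anything can be computed:
  \<open>act\<close> picks a representing word, \<open>arrows\<close> quantifies over all orderings
  of \<open>S\<close> with product \<open>c\<close>, and \<open>W1\<close> and \<open>W_root\<close>
  are definite descriptions. For \<open>act\<close> this requires the defining relations for the
  reflections. For \<open>arrows\<close>, two orderings with the same product must order adjacent
  vertices alike; this is read off from the action on a simple root, so no solution of the word
  problem enters. Uniqueness of \<open>W1\<close> and minimality in \<open>W_root\<close> both come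
  from one exchange property of sink sequences. Positivity is obtained in two ways. For words
  without repeated letters it follows from the signs of the off-diagonal entries of the form. A
  projective root, however, is given as the image of a simple root under an arbitrary word, and the
  roots met while its admissible word is applied must have constant sign. Only there does the
  general sign theorem enter; it rests on the rank two computation with alternating words.\<close>

fun alternating :: "'a \<Rightarrow> 'a \<Rightarrow> nat \<Rightarrow> 'a list" where
  "alternating a b 0 = []"
| "alternating a b (Suc n) = a # alternating b a n"

lemma length_alternating [simp]: "length (alternating a b n) = n"
  by (induction a b n rule: alternating.induct) auto

lemma alternating_in_lists: "a \<in> A \<Longrightarrow> b \<in> A \<Longrightarrow> alternating a b n \<in> lists A"
  by (induction a b n rule: alternating.induct) auto

lemma alternating_append:
  "alternating a b (p + q) = alternating a b p @ (if even p then alternating a b q else alternating b a q)"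
  by (induction a b p rule: alternating.induct) auto

lemma rev_alternating:
  "rev (alternating a b n) = (if even n then alternating b a n else alternating a b n)"
proof (induction n)
  case (Suc n)
  have "rev (alternating a b (Suc n)) = (if even n then [a] else [b]) @ rev (alternating a b n)"
    using alternating_append[of a b n 1] by simp
  then show ?case
    using Suc by simp
qed simp

lemma concat_replicate_alternating: "concat (replicate k [a, b]) = alternating a b (2 * k)"
  by (induction k) auto

lemma alternating_double: "alternating a b (2 * n) = alternating a b n @ rev (alternating b a n)"
  using alternating_append[of a b n n] by (simp add: rev_alternating mult_2)

lemma alternating_of_reduced:
  assumes "set d \<subseteq> {a, b}" "a \<noteq> b" "d = [] \<or> hd d = a"
    and "\<And>xs y ys. d \<noteq> xs @ y # y # ys"
  shows "d = alternating a b (length d)"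
  using assms
proof (induction d arbitrary: a b)
  case (Cons x d)
  have x: "x = a"
    using Cons.prems(3) by simp
  have "hd d \<noteq> a" if "d \<noteq> []"
    using Cons.prems(4)[of "[]" a "tl d"] x that by (metis append_Nil list.collapse)
  then have "d = [] \<or> hd d = b"
    using Cons.prems(1) by (cases d) auto
  moreover have "d \<noteq> xs @ y # y # ys" for xs y ys
    using Cons.prems(4)[of "x # xs"] by simp
  ultimately have "d = alternating b a (length d)"
    using Cons.prems(1,2) by (intro Cons.IH) auto
  then show ?case
    using x by simp
qed simp

lemma alpha_apply: "alpha s t = (if t = s then 1 else 0)"
  by (simp add: alpha_def)

locale coxeter_geometry =
  fixes W :: "('w, 'v) coxeter_data"
  assumes system: "coxeter_system W"
    and finite_gens: "finite (gens W)"
begin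

definition gram :: "'w \<Rightarrow> 'w \<Rightarrow> real" where
  "gram s t = - 2 * cos (pi_over (cox_mat W s t))"

text \<open>The functional \<open>bform W (alpha s)\<close>, by \<open>bform_alpha_left\<close>. A
  reflection subtracts exactly this number from its own coordinate, so all computations below run
  through these functionals.\<close>

definition pairing :: "'w \<Rightarrow> ('w \<Rightarrow> real) \<Rightarrow> real" where
  "pairing s v = (\<Sum>t\<in>gens W. gram s t * v t)"

abbreviation opr :: "'w list \<Rightarrow> ('w \<Rightarrow> real) \<Rightarrow> 'w \<Rightarrow> real" where
  "opr \<equiv> foldr (reflection W)"

lemma matrix: "coxeter_matrix (gens W) (cox_mat W)"
  using system by (simp add: coxeter_system_def)

lemma gram_self [simp]: "s \<in> gens W \<Longrightarrow> gram s s = 2"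
  using matrix by (simp add: coxeter_matrix_def gram_def one_enat_def)

lemma gram_sym: "s \<in> gens W \<Longrightarrow> t \<in> gens W \<Longrightarrow> gram s t = gram t s"
  using matrix unfolding coxeter_matrix_def gram_def by metis

lemma two_le_enat_cases:
  assumes "2 \<le> (m :: enat)"
  obtains k where "m = enat k" "2 \<le> k" | "m = \<infinity>"
  using assms by (cases m) (auto simp: numeral_eq_enat)

lemma gram_nonpos:
  assumes "s \<in> gens W" "t \<in> gens W" "s \<noteq> t"
  shows "gram s t \<le> 0"
proof -
  have "2 \<le> cox_mat W s t"
    using matrix assms by (simp add: coxeter_matrix_def)
  then show ?thesis
  proof (cases rule: two_le_enat_cases)
    case (1 k)
    then have "pi / real k \<le> pi / 2"
      by (intro divide_left_mono) auto
    moreover have "- (pi / 2) \<le> pi / real k"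
      by (rule order_trans[of _ 0]) auto
    ultimately have "0 \<le> cos (pi / real k)"
      by (intro cos_ge_zero)
    then show ?thesis
      using 1 by (simp add: gram_def)
  qed (simp add: gram_def)
qed

text \<open>The angle \<open>pi / k\<close> has a nonzero cosine once \<open>k > 2\<close>, and an
  infinite entry gives the value -2. Hence edges of the Coxeter graph can be tested by the
  form.\<close>

lemma gram_eq_0_iff:
  assumes "s \<in> gens W" "t \<in> gens W" "s \<noteq> t"
  shows "gram s t = 0 \<longleftrightarrow> \<not> 2 < cox_mat W s t"
proof -
  have "2 \<le> cox_mat W s t"
    using matrix assms by (simp add: coxeter_matrix_def)
  then show ?thesis
  proof (cases rule: two_le_enat_cases)
    case (1 k)
    show ?thesis
    proof (cases "k = 2")
      case True
      then show ?thesis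
        using 1 by (simp add: gram_def numeral_eq_enat)
    next
      case False
      then have "pi / real k < pi / 2"
        using 1 by (intro divide_strict_left_mono) auto
      moreover have "0 < pi / real k"
        using 1 by simp
      ultimately have "0 < cos (pi / real k)"
        by (intro cos_gt_zero_pi) auto
      then show ?thesis
        using 1 False by (simp add: gram_def numeral_eq_enat)
    qed
  qed (simp add: gram_def numeral_eq_enat)
qed

lemma bform_alpha_left:
  assumes "s \<in> gens W"
  shows "bform W (alpha s) v = pairing s v"
proof -
  have "bform W (alpha s) v = (\<Sum>r\<in>gens W. if r = s then pairing s v else 0)"
    unfolding bform_def pairing_def gram_def alpha_apply
    by (intro sum.cong) (auto simp: mult_ac)
  then show ?thesis
    using assms finite_gens by simp
qed

lemma pairing_alpha:
  assumes "t \<in> gens W"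
  shows "pairing s (alpha t) = gram s t"
proof -
  have "pairing s (alpha t) = (\<Sum>r\<in>gens W. if r = t then gram s t else 0)"
    unfolding pairing_def alpha_apply by (intro sum.cong) auto
  then show ?thesis
    using assms finite_gens by simp
qed

lemma pairing_lin: "pairing s (\<lambda>r. a * u r + b * v r) = a * pairing s u + b * pairing s v"
  by (simp add: pairing_def sum.distrib sum_distrib_left algebra_simps)

lemma reflection_apply:
  "s \<in> gens W \<Longrightarrow> reflection W s v t = v t - (if t = s then pairing s v else 0)"
  by (simp add: reflection_def bform_alpha_left alpha_apply)

lemma reflection_lin:
  assumes "s \<in> gens W"
  shows "reflection W s (\<lambda>r. a * u r + b * v r) = (\<lambda>r. a * reflection W s u r + b * reflection W s v r)"
  using assms by (auto simp: reflection_apply pairing_lin algebra_simps)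

lemma opr_lin:
  assumes "set w \<subseteq> gens W"
  shows "opr w (\<lambda>r. a * u r + b * v r) = (\<lambda>r. a * opr w u r + b * opr w v r)"
  using assms by (induction w) (auto simp: reflection_lin)

lemma opr_uminus:
  assumes "set w \<subseteq> gens W"
  shows "opr w (- v) = - opr w v"
  using opr_lin[OF assms, of "-1" v 0 v] by (simp add: fun_Compl_def)

lemma reflection_alpha_self: "s \<in> gens W \<Longrightarrow> reflection W s (alpha s) = - alpha s"
  by (rule ext) (auto simp: reflection_apply pairing_alpha alpha_apply)

lemma pairing_reflection:
  assumes "s \<in> gens W"
  shows "pairing t (reflection W s v) = pairing t v - gram t s * pairing s v"
proof -
  have "reflection W s v = (\<lambda>r. 1 * v r + (- pairing s v) * alpha s r)"
    using assms by (auto simp: reflection_apply alpha_apply)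
  then show ?thesis
    using assms by (simp only: pairing_lin pairing_alpha) simp
qed

lemma reflection_reflection [simp]:
  assumes "s \<in> gens W"
  shows "reflection W s (reflection W s v) = v"
  using assms by (intro ext) (auto simp: reflection_apply pairing_reflection)

lemma opr_rev_cancel:
  assumes "set w \<subseteq> gens W"
  shows "opr (rev w) (opr w v) = v"
  using assms by (induction w arbitrary: v) auto

lemma opr_rev_cancel':
  assumes "set w \<subseteq> gens W"
  shows "opr w (opr (rev w) v) = v"
  using opr_rev_cancel[of "rev w"] assms by simp

lemma opr_outside:
  assumes "set w \<subseteq> gens W" "r \<notin> set w"
  shows "opr w v r = v r"
  using assms by (induction w) (auto simp: reflection_apply)

text \<open>The quadratic form of \<open>bform\<close>, which may be indefinite. Its invariance
  fixes the scale of a root that is a multiple of a simple root.\<close>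

definition sq_norm :: "('w \<Rightarrow> real) \<Rightarrow> real" where
  "sq_norm v = (\<Sum>s\<in>gens W. v s * pairing s v)"

lemma sq_norm_reflection:
  assumes "s \<in> gens W"
  shows "sq_norm (reflection W s v) = sq_norm v"
proof -
  let ?p = "pairing s v"
  have "sq_norm (reflection W s v) =
    (\<Sum>t\<in>gens W. v t * pairing t v - ?p * (gram s t * v t)
       - (if t = s then ?p * pairing s v - ?p * (?p * 2) else 0))"
    unfolding sq_norm_def
    using assms
    by (intro sum.cong) (auto simp: reflection_apply pairing_reflection gram_sym algebra_simps)
  also have "\<dots> = sq_norm v - ?p * ?p - (?p * ?p - ?p * (?p * 2))"
    using assms finite_gens
    by (simp add: sum_subtractf sq_norm_def sum_distrib_left[symmetric] pairing_def[symmetric])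
  finally show ?thesis
    by simp
qed

lemma sq_norm_opr: "set w \<subseteq> gens W \<Longrightarrow> sq_norm (opr w v) = sq_norm v"
  by (induction w) (auto simp: sq_norm_reflection)

lemma sq_norm_scaled_alpha:
  assumes "s \<in> gens W"
  shows "sq_norm (\<lambda>r. d * alpha s r) = 2 * d\<^sup>2"
proof -
  have "pairing t (\<lambda>r. d * alpha s r) = d * gram t s" for t
    using pairing_lin[of t d "alpha s" 0] assms by (simp add: pairing_alpha)
  then have "sq_norm (\<lambda>r. d * alpha s r) = (\<Sum>t\<in>gens W. if t = s then 2 * d\<^sup>2 else 0)"
    unfolding sq_norm_def
    using assms by (intro sum.cong) (auto simp: alpha_apply power2_eq_square)
  then show ?thesis
    using assms finite_gens by simp
qed

text \<open>In the plane of \<open>alpha s\<close> and \<open>alpha t\<close> a reflection replaces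
  only one coefficient, and \<open>g n\<close> becomes \<open>- gram s t * g (n + 1) - g n\<close>,
  which is \<open>g (n + 2)\<close>. Each step thus moves a window of two consecutive terms of
  \<open>g\<close> by one; the induction exchanges \<open>s\<close> and \<open>t\<close> and shifts
  \<open>g\<close>.\<close>

lemma fold_alternating:
  assumes "s \<in> gens W" "t \<in> gens W" "s \<noteq> t"
    and "\<And>n. g (n + 2) = - gram s t * g (n + 1) - g n"
  shows "fold (reflection W) (alternating t s q) (\<lambda>r. g 0 * alpha t r + g 1 * alpha s r) =
    (if even q then (\<lambda>r. g q * alpha t r + g (q + 1) * alpha s r)
     else (\<lambda>r. g q * alpha s r + g (q + 1) * alpha t r))"
  using assms
proof (induction q arbitrary: s t g)
  case (Suc q)
  have "reflection W t (\<lambda>r. g 0 * alpha t r + g 1 * alpha s r) =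
    (\<lambda>r. g 0 * reflection W t (alpha t) r + g 1 * reflection W t (alpha s) r)"
    using Suc.prems(2) by (rule reflection_lin)
  also have "\<dots> = (\<lambda>r. g 1 * alpha s r + g (Suc (Suc 0)) * alpha t r)"
    using Suc.prems(1-3) Suc.prems(4)[of 0] gram_sym[of s t]
    by (auto simp: fun_eq_iff reflection_apply pairing_alpha numeral_2_eq_2 algebra_simps)
      (auto simp: alpha_apply)
  finally have "reflection W t (\<lambda>r. g 0 * alpha t r + g 1 * alpha s r) =
    (\<lambda>r. g 1 * alpha s r + g (Suc (Suc 0)) * alpha t r)" .
  moreover have "fold (reflection W) (alternating s t q) (\<lambda>r. g (Suc 0) * alpha s r + g (Suc 1) * alpha t r) =
    (if even q then (\<lambda>r. g (Suc q) * alpha s r + g (Suc (q + 1)) * alpha t r)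
     else (\<lambda>r. g (Suc q) * alpha t r + g (Suc (q + 1)) * alpha s r))"
    using Suc.prems gram_sym[of s t] Suc.prems(4)[of "Suc _"] by (intro Suc.IH[of t s "\<lambda>n. g (Suc n)"]) simp_all
  ultimately show ?case
    by simp
qed auto

text \<open>This is \<open>sin (x + \<theta>) + sin (x - \<theta>) = 2 * sin x * cos
  \<theta>\<close>. The free phase \<phi> gives enough solutions to span the plane.\<close>

lemma sine_recurrence:
  "gram s t = - 2 * cos \<theta> \<Longrightarrow>
    sin (\<phi> + real (n + 2) * \<theta>) = - gram s t * sin (\<phi> + real (n + 1) * \<theta>) - sin (\<phi> + real n * \<theta>)"
proof -
  assume *: "gram s t = - 2 * cos \<theta>"
  let ?x = "\<phi> + real (n + 1) * \<theta>"
  have "\<phi> + real (n + 2) * \<theta> = ?x + \<theta>" "\<phi> + real n * \<theta> = ?x - \<theta>"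
    by (simp_all add: algebra_simps)
  then show ?thesis
    by (simp only: * sin_add sin_diff) (simp add: algebra_simps)
qed

lemma gram_finite:
  assumes "cox_mat W s t = enat k"
  shows "gram s t = - 2 * cos (pi / real k)"
  using assms by (simp add: gram_def)

lemma cox_mat_finite_ge_2:
  assumes "s \<in> gens W" "t \<in> gens W" "s \<noteq> t" "cox_mat W s t = enat k"
  shows "2 \<le> k"
  using matrix assms unfolding coxeter_matrix_def by (metis enat_ord_simps(1) numeral_eq_enat)

lemma sin_pi_over_pos: "2 \<le> k \<Longrightarrow> 0 < sin (pi / real k)"
  by (intro sin_gt_zero) (auto simp: field_simps)

lemma fold_fixed:
  assumes "set w \<subseteq> gens W" "\<And>r. r \<in> set w \<Longrightarrow> pairing r v = 0"
  shows "fold (reflection W) w v = v"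
  using assms
proof (induction w)
  case (Cons z w)
  then have "reflection W z v = v"
    by (auto simp: reflection_apply)
  then show ?case
    using Cons by simp
qed simp

text \<open>Away from the plane spanned by \<open>alpha s\<close> and \<open>alpha t\<close> the operator is trivial because the
  form is nondegenerate on that plane; on the plane it is the rotation by \<open>2 * pi / k\<close>.\<close>

lemma opr_braid:
  assumes s: "s \<in> gens W" and t: "t \<in> gens W" and ne: "s \<noteq> t" and k: "cox_mat W s t = enat k"
  shows "opr (alternating s t (2 * k)) v = v"
proof -
  define \<theta> where "\<theta> = pi / real k"
  have k2: "2 \<le> k"
    using cox_mat_finite_ge_2[OF s t ne k] .
  have sin: "sin \<theta> > 0"
    using k2 sin_pi_over_pos by (simp add: \<theta>_def)
  have g: "gram s t = - 2 * cos \<theta>" "gram t s = - 2 * cos \<theta>"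
    using gram_finite[OF k] gram_sym[OF s t] by (simp_all add: \<theta>_def)
  have k\<theta>: "real k * \<theta> = pi"
    using k2 by (simp add: \<theta>_def)
  have "\<phi> + 2 * real k * \<theta> = \<phi> + 2 * pi" "\<phi> + (1 + 2 * real k) * \<theta> = \<phi> + \<theta> + 2 * pi" for \<phi>
    using k\<theta> by (simp_all add: algebra_simps)
  then have period: "sin (\<phi> + 2 * real k * \<theta>) = sin \<phi>" "sin (\<phi> + (1 + 2 * real k) * \<theta>) = sin (\<phi> + \<theta>)" for \<phi>
    by (simp_all only: sin_periodic)
  \<comment> \<open>Two consecutive terms of the sine solution with phase \<phi>. After
    \<open>2 * k\<close> reflections the phase has grown by \<open>2 * pi\<close>, so the vector has
    returned to itself.\<close>
  let ?P = "\<lambda>\<phi> r. sin \<phi> * alpha t r + sin (\<phi> + \<theta>) * alpha s r"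
  let ?F = "opr (alternating s t (2 * k))"
  have F: "?F = fold (reflection W) (alternating t s (2 * k))"
    by (simp add: foldr_conv_fold rev_alternating)
  have rot: "?F (?P \<phi>) = ?P \<phi>" for \<phi>
    using fold_alternating[OF s t ne, of "\<lambda>n. sin (\<phi> + real n * \<theta>)" "2 * k"]
      sine_recurrence[OF g(1), of \<phi>]
    unfolding F by (simp add: period)
  have lin: "?F (\<lambda>r. a * u r + b * w r) = (\<lambda>r. a * ?F u r + b * ?F w r)" for a b u w
    using opr_lin[of "alternating s t (2 * k)"] alternating_in_lists[OF s t, of "2 * k"] by blast
  have Fs: "?F (alpha s) = alpha s"
  proof -
    \<comment> \<open>Phase 0 removes the \<open>alpha t\<close> term; below, phase
      \<open>- \<theta>\<close> removes the \<open>alpha s\<close> term.\<close>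
    have "alpha s = (\<lambda>r. (1 / sin \<theta>) * ?P 0 r + 0 * ?P 0 r)"
      using sin by auto
    then show ?thesis
      using lin[of "1 / sin \<theta>" "?P 0" 0 "?P 0"] rot[of 0] by simp
  qed
  have Ft: "?F (alpha t) = alpha t"
  proof -
    have "alpha t = (\<lambda>r. (- 1 / sin \<theta>) * ?P (- \<theta>) r + 0 * ?P 0 r)"
      using sin by auto
    then show ?thesis
      using lin[of "- 1 / sin \<theta>" "?P (- \<theta>)" 0 "?P 0"] rot[of "- \<theta>"] by simp
  qed
  define p q where "p = pairing s v" and "q = pairing t v"
  \<comment> \<open>Cramer's rule for the two equations making \<open>v0\<close> orthogonal to
    \<open>alpha s\<close> and \<open>alpha t\<close>; the determinant is
    \<open>4 * (sin \<theta>)\<^sup>2\<close>.\<close>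
  define x y where "x = (p + q * cos \<theta>) / (2 * (sin \<theta>)\<^sup>2)" and "y = (q + p * cos \<theta>) / (2 * (sin \<theta>)\<^sup>2)"
  define v0 where "v0 = (\<lambda>r. 1 * v r + (-1) * (x * alpha s r + y * alpha t r))"
  have c2: "(cos \<theta>)\<^sup>2 = 1 - (sin \<theta>)\<^sup>2"
    by (simp add: cos_squared_eq)
  have "pairing s v0 = p - (2 * x - 2 * y * cos \<theta>)" "pairing t v0 = q - (2 * y - 2 * x * cos \<theta>)"
    unfolding v0_def pairing_lin using s t g by (simp_all add: pairing_alpha p_def q_def)
  moreover have "2 * x - 2 * y * cos \<theta> = p * (1 - (cos \<theta>)\<^sup>2) / (sin \<theta>)\<^sup>2"
    "2 * y - 2 * x * cos \<theta> = q * (1 - (cos \<theta>)\<^sup>2) / (sin \<theta>)\<^sup>2"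
    using sin by (simp_all add: x_def y_def field_simps power2_eq_square)
  ultimately have "pairing s v0 = 0" "pairing t v0 = 0"
    using sin by (simp_all add: c2)
  then have "?F v0 = v0"
    unfolding F
    using alternating_in_lists[of t "{s, t}" s "2 * k"] s t by (intro fold_fixed) auto
  then have "?F (\<lambda>r. 1 * v0 r + 1 * (x * alpha s r + y * alpha t r)) =
      (\<lambda>r. 1 * v0 r + 1 * (x * alpha s r + y * alpha t r))"
    unfolding lin Fs Ft by simp
  then show ?thesis
    by (simp add: v0_def)
qed

text \<open>By \<open>alternating_double\<close> the trivially acting word of
  \<open>opr_braid\<close> is one side followed by the reverse of the other, and reversing a word
  inverts its operator.\<close>

lemma opr_alternating_eq:
  assumes "s \<in> gens W" "t \<in> gens W" "s \<noteq> t" "cox_mat W s t = enat k"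
  shows "opr (alternating s t k) = opr (alternating t s k)"
proof
  fix v
  have *: "set (alternating t s k) \<subseteq> gens W"
    using alternating_in_lists[of t "gens W" s k] assms by auto
  have "opr (alternating s t k) (opr (rev (alternating t s k)) (opr (alternating t s k) v)) = opr (alternating t s k) v"
    using opr_braid[OF assms, of "opr (alternating t s k) v"] by (simp add: alternating_double)
  then show "opr (alternating s t k) v = opr (alternating t s k) v"
    using opr_rev_cancel[OF *] by simp
qed

lemma opr_rev_alternating_eq:
  assumes "s \<in> gens W" "t \<in> gens W" "s \<noteq> t" "cox_mat W s t = enat k"
  shows "opr (rev (alternating s t k)) = opr (rev (alternating t s k))"
  using opr_alternating_eq[OF assms] by (auto simp: rev_alternating)

lemma alternating_alpha_nonneg:
  assumes s: "s \<in> gens W" and t: "t \<in> gens W" and ne: "s \<noteq> t"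
    and q: "\<And>k. cox_mat W s t = enat k \<Longrightarrow> q < k"
  shows "\<exists>a b. 0 \<le> a \<and> 0 \<le> b \<and>
    opr (rev (alternating t s q)) (alpha s) = (\<lambda>r. a * alpha s r + b * alpha t r)"
proof -
  \<comment> \<open>The initial terms 0 and 1 encode the start vector \<open>alpha s\<close>. After
    \<open>q\<close> steps the coefficients are \<open>g q\<close> and \<open>g (q + 1)\<close>, and
    \<open>sin (n * \<theta>) / sin \<theta>\<close> is nonnegative up to \<open>n = k\<close>;
    hence the bound \<open>q < k\<close>.\<close>
  have "\<exists>g :: nat \<Rightarrow> real. (\<forall>n. g (n + 2) = - gram s t * g (n + 1) - g n) \<and> g 0 = 0 \<and> g 1 = 1 \<and>
      0 \<le> g q \<and> 0 \<le> g (q + 1)"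
  proof (cases "cox_mat W s t")
    case (enat k)
    define \<theta> where "\<theta> = pi / real k"
    have k2: "2 \<le> k"
      using cox_mat_finite_ge_2[OF s t ne enat] .
    have sin: "sin \<theta> > 0"
      using k2 sin_pi_over_pos by (simp add: \<theta>_def)
    have g: "gram s t = - 2 * cos \<theta>"
      using gram_finite[OF enat] by (simp add: \<theta>_def)
    have nonneg: "0 \<le> sin (real n * \<theta>)" if "n \<le> k" for n
      using that k2 by (intro sin_ge_zero) (auto simp: \<theta>_def field_simps)
    have "\<forall>n. sin (real (n + 2) * \<theta>) / sin \<theta> =
        - gram s t * (sin (real (n + 1) * \<theta>) / sin \<theta>) - sin (real n * \<theta>) / sin \<theta>"
      using sine_recurrence[OF g, of 0] sin by (simp add: field_simps)
    then show ?thesis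
      using sin q[OF enat] nonneg[of q] nonneg[of "q + 1"]
      by (intro exI[of _ "\<lambda>n. sin (real n * \<theta>) / sin \<theta>"]) (auto intro!: divide_nonneg_pos)
  next
    \<comment> \<open>Here \<open>gram s t = -2\<close>, and the recurrence has the solution
      \<open>g n = n\<close>.\<close>
    case infinity
    then show ?thesis
      by (intro exI[of _ real]) (simp add: gram_def)
  qed
  then obtain g :: "nat \<Rightarrow> real" where g: "\<And>n. g (n + 2) = - gram s t * g (n + 1) - g n"
      "g 0 = 0" "g 1 = 1" "0 \<le> g q" "0 \<le> g (q + 1)"
    by blast
  have "opr (rev (alternating t s q)) (alpha s) = fold (reflection W) (alternating t s q) (\<lambda>r. g 0 * alpha t r + g 1 * alpha s r)"
    by (simp only: g foldr_conv_fold) simp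
  also have "\<dots> = (if even q then (\<lambda>r. g (q + 1) * alpha s r + g q * alpha t r)
      else (\<lambda>r. g q * alpha s r + g (q + 1) * alpha t r))"
    using fold_alternating[OF s t ne, of g q] g(1) by (auto simp: add.commute)
  finally show ?thesis
    using g(4,5) by (cases "even q") auto
qed

end

section \<open>Roots have constant sign\<close>

context coxeter_geometry
begin

definition reduced :: "'w list \<Rightarrow> bool" where
  "reduced u \<longleftrightarrow> u \<in> lists (gens W) \<and>
    (\<forall>v\<in>lists (gens W). opr v = opr u \<longrightarrow> length u \<le> length v)"

lemma obtain_reduced:
  assumes "u \<in> lists (gens W)"
  obtains v where "reduced v" "opr v = opr u" "length v \<le> length u"
proof -
  have "\<exists>v. v \<in> lists (gens W) \<and> opr v = opr u"
    using assms by blast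
  then obtain v where v: "v \<in> lists (gens W)" "opr v = opr u"
      "\<And>v'. v' \<in> lists (gens W) \<Longrightarrow> opr v' = opr u \<Longrightarrow> length v \<le> length v'"
    using ex_has_least_nat[of "\<lambda>v. v \<in> lists (gens W) \<and> opr v = opr u" _ length] by metis
  then show ?thesis
    using assms by (intro that[of v]) (simp_all add: reduced_def)
qed

lemma opr_append: "opr (u @ v) = opr u \<circ> opr v"
  by (simp add: fun_eq_iff)

lemma opr_append_cancel: "s \<in> gens W \<Longrightarrow> opr (u @ [s, s]) = opr u"
  by (auto simp: fun_eq_iff)

text \<open>Deodhar's argument as in Humphreys, Section 5.4: split off from the right of \<open>u\<close> the longest
  possible word in the last letter \<open>t\<close> of \<open>u\<close> and \<open>s\<close>; this word alternates, and it ends in \<open>t\<close>, so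
  that it sends \<open>alpha s\<close> to a nonnegative combination of \<open>alpha s\<close> and \<open>alpha t\<close>. Lengths are
  taken in the group of operators rather than in \<open>W\<close>.\<close>

lemma reduced_nonneg:
  assumes "reduced u" "s \<in> gens W"
    and "\<And>v. v \<in> lists (gens W) \<Longrightarrow> opr v = opr (u @ [s]) \<Longrightarrow> length u \<le> length v"
  shows "0 \<le> opr u (alpha s) r"
  using assms
proof (induction "length u" arbitrary: u s r rule: less_induct)
  case less
  note red = less.prems(1) and s = less.prems(2) and us = less.prems(3)
  show ?case
  proof (cases u rule: rev_cases)
    case Nil
    then show ?thesis
      by (simp add: alpha_apply)
  next
    case (snoc u' t)
    have u: "u \<in> lists (gens W)"
      and umin: "\<And>v. v \<in> lists (gens W) \<Longrightarrow> opr v = opr u \<Longrightarrow> length u \<le> length v"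
      using red by (auto simp: reduced_def)
    have t: "t \<in> gens W"
      using u snoc by simp
    have "t \<noteq> s"
    proof
      assume "t = s"
      then have "opr (u @ [s]) = opr u'"
        using snoc opr_append_cancel[OF s] by simp
      then show False
        using us[of u'] u snoc by simp
    qed
    define split where "split v d \<longleftrightarrow> v \<in> lists (gens W) \<and> d \<in> lists {s, t} \<and>
        opr (v @ d) = opr u \<and> length v + length d = length u" for v d
    have "\<exists>v. \<exists>d. split v d"
      using u snoc by (intro exI[of _ u'] exI[of _ "[t]"]) (auto simp: split_def)
    then obtain v where "\<exists>d. split v d" and vmin: "\<And>v' d. split v' d \<Longrightarrow> length v \<le> length v'"
      using ex_has_least_nat[of "\<lambda>v. \<exists>d. split v d" _ length] by metis
    then obtain d where d: "split v d"
      by blast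
    have "split u' [t]"
      using u snoc by (auto simp: split_def)
    then have "length v < length u"
      using vmin[of u' "[t]"] snoc by simp
    have v: "v \<in> lists (gens W)" and d_lists: "d \<in> lists (gens W)" and d_set: "set d \<subseteq> {s, t}"
      and vd: "opr (v @ d) = opr u" and len: "length v + length d = length u"
      using d s t by (auto simp: split_def)
    have "reduced v"
      unfolding reduced_def
    proof (intro conjI ballI impI)
      fix v' assume "v' \<in> lists (gens W)" "opr v' = opr v"
      then show "length v \<le> length v'"
        using umin[of "v' @ d"] d_lists vd len by (simp add: opr_append)
    qed (fact v)
    \<comment> \<open>If a word for \<open>v a\<close> were shorter than \<open>v\<close>, putting
      \<open>a\<close> in front of \<open>d\<close> would give a split of \<open>u\<close> with a
      shorter left part.\<close>
    have IH: "0 \<le> opr v (alpha a) r" if a: "a \<in> {s, t}" for a r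
    proof (rule less.hyps[OF \<open>length v < length u\<close> \<open>reduced v\<close>])
      show "a \<in> gens W"
        using a s t by blast
      fix v' assume v': "v' \<in> lists (gens W)" "opr v' = opr (v @ [a])"
      have "opr (v' @ (a # d)) = opr u"
        using v'(2) vd \<open>a \<in> gens W\<close> by (auto simp: fun_eq_iff)
      then have "length u \<le> length v' + Suc (length d)"
        using umin[of "v' @ (a # d)"] v'(1) d_lists \<open>a \<in> gens W\<close> by simp
      moreover have "length v \<le> length v'" if "length v' < length v"
      proof (rule vmin)
        show "split v' (a # d)"
          using v' d a \<open>opr (v' @ (a # d)) = opr u\<close> calculation that len by (simp add: split_def)
      qed
      ultimately show "length v \<le> length v'"
        by linarith
    qed
    have dmin: "length d \<le> length d'" if "d' \<in> lists (gens W)" "opr d' = opr d" for d'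
      using umin[of "v @ d'"] that v vd len by (simp add: opr_append)
    \<comment> \<open>If \<open>d\<close> could be rewritten to end in \<open>s\<close> without
      growing, deleting that letter would give a word for \<open>u s\<close> shorter than
      \<open>u\<close>.\<close>
    have not_ending: False if "d' \<in> lists (gens W)" "opr (d' @ [s]) = opr d" "length d' < length d" for d'
    proof -
      have "opr d' w = opr (d @ [s]) w" for w
        using fun_cong[OF that(2), of "reflection W s w"] s by simp
      then have "opr d' = opr (d @ [s])" ..
      then have "opr (v @ d') = opr (v @ d @ [s])"
        by (simp only: opr_append)
      also have "\<dots> = opr (u @ [s])"
        using vd by (metis append.assoc opr_append)
      finally show False
        using us[of "v @ d'"] v that(1,3) len by simp
    qed
    have alt: "rev d = alternating t s (length d)"
    proof -
      have "rev d = alternating t s (length (rev d))"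
      proof (rule alternating_of_reduced)
        show "set (rev d) \<subseteq> {t, s}" "t \<noteq> s"
          using d_set \<open>t \<noteq> s\<close> by auto
        show "rev d = [] \<or> hd (rev d) = t"
        proof (rule ccontr)
          assume "\<not> ?thesis"
          then have "d \<noteq> []" "last d \<noteq> t"
            by (auto simp: hd_rev)
          then have "last d = s"
            using d_set last_in_set[of d] by blast
          then have d_eq: "d = butlast d @ [s]"
            using append_butlast_last_id[OF \<open>d \<noteq> []\<close>] by simp
          then have "butlast d \<in> lists (gens W)" "length (butlast d) < length d"
            using d_lists \<open>d \<noteq> []\<close> by (metis append_in_lists_conv, simp)
          then show False
            using not_ending[of "butlast d"] d_eq by metis
        qed
        fix xs y ys
        show "rev d \<noteq> xs @ y # y # ys"
        proof
          assume "rev d = xs @ y # y # ys"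
          then have d: "d = rev ys @ [y, y] @ rev xs"
            by (simp add: rev_swap)
          moreover have "y \<in> gens W"
            using d d_lists by simp
          then have "opr (rev ys @ rev xs) = opr d"
            unfolding d by (auto simp: fun_eq_iff)
          ultimately show False
            using dmin[of "rev ys @ rev xs"] d_lists by simp
        qed
      qed
      then show ?thesis
        by simp
    qed
    \<comment> \<open>Otherwise the last \<open>k\<close> letters of \<open>d\<close> could be
      exchanged for the other alternating word of length \<open>k\<close>, which ends in
      \<open>s\<close>.\<close>
    have short: "length d < k" if k: "cox_mat W s t = enat k" for k
    proof (rule ccontr)
      assume "\<not> length d < k"
      then obtain j where j: "length d = k + j"
        by (meson le_Suc_ex not_less)
      have "rev d = alternating t s (k + j)"
        using alt j by simp
      then obtain e where e: "rev d = alternating t s k @ e"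
        unfolding alternating_append by blast
      then have d: "d = rev e @ rev (alternating t s k)"
        by (simp add: rev_swap)
      have k2: "2 \<le> k"
        using cox_mat_finite_ge_2[OF s t \<open>t \<noteq> s\<close>[symmetric] k] .
      have "opr d = opr (rev e @ rev (alternating s t k))"
        unfolding d by (simp only: opr_append opr_rev_alternating_eq[OF s t \<open>t \<noteq> s\<close>[symmetric] k])
      moreover have "rev (alternating s t k) = rev (alternating t s (k - 1)) @ [s]"
        using k2 by (cases k) auto
      ultimately have "opr ((rev e @ rev (alternating t s (k - 1))) @ [s]) = opr d"
        by simp
      moreover have "rev e \<in> lists (gens W)"
        using d_lists d by simp
      moreover have "rev (alternating t s (k - 1)) \<in> lists (gens W)"
        using alternating_in_lists[OF t s, of "k - 1"] by (simp add: in_lists_conv_set)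
      ultimately show False
        using k2 by (intro not_ending[of "rev e @ rev (alternating t s (k - 1))"]) (auto simp: d)
    qed
    obtain a b where ab: "0 \<le> a" "0 \<le> b" "opr d (alpha s) = (\<lambda>r. a * alpha s r + b * alpha t r)"
      using alternating_alpha_nonneg[OF s t \<open>t \<noteq> s\<close>[symmetric] short] alt by (metis rev_rev_ident)
    have "opr u (alpha s) = opr v (opr d (alpha s))"
      using vd by (metis comp_apply foldr_append)
    also have "\<dots> = (\<lambda>r. a * opr v (alpha s) r + b * opr v (alpha t) r)"
      unfolding ab(3) using v by (intro opr_lin) auto
    finally show ?thesis
      using ab(1,2) IH by simp
  qed
qed

text \<open>Let \<open>w\<close> be a reduced word for the operator of \<open>u\<close>. If
  appending \<open>s\<close> does not shorten it, \<open>reduced_nonneg\<close> applies to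
  \<open>w\<close>. If it does, the lemma applies to a reduced word for \<open>w s\<close>, and the
  sign flips because \<open>s\<close> negates \<open>alpha s\<close>.\<close>

lemma opr_alpha_sign:
  assumes "u \<in> lists (gens W)" "s \<in> gens W"
  shows "(\<forall>r. 0 \<le> opr u (alpha s) r) \<or> (\<forall>r. opr u (alpha s) r \<le> 0)"
proof -
  obtain w where w: "reduced w" "opr w = opr u"
    using obtain_reduced[OF assms(1)] by blast
  show ?thesis
  proof (cases "\<forall>v\<in>lists (gens W). opr v = opr (w @ [s]) \<longrightarrow> length w \<le> length v")
    case True
    then show ?thesis
      using reduced_nonneg[OF w(1) assms(2)] w(2) by simp
  next
    case False
    then obtain v0 where "v0 \<in> lists (gens W)" "opr v0 = opr (w @ [s])" "length v0 < length w"
      by force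
    then obtain v where v: "reduced v" "opr v = opr (w @ [s])" "length v < length w"
      using obtain_reduced[of v0] by (metis le_less_trans)
    have vs: "opr (v @ [s]) = opr w"
      using v(2) assms(2) by (auto simp: fun_eq_iff)
    have "0 \<le> opr v (alpha s) r" for r
    proof (rule reduced_nonneg[OF v(1) assms(2)])
      fix v' assume "v' \<in> lists (gens W)" "opr v' = opr (v @ [s])"
      then show "length v \<le> length v'"
        using w(1) v(3) vs by (fastforce simp: reduced_def)
    qed
    moreover have "opr u (alpha s) = - opr v (alpha s)"
    proof -
      have "opr u (alpha s) = opr v (reflection W s (alpha s))"
        using vs w(2) by (metis comp_apply foldr.simps foldr_append id_comp comp_id)
      then show ?thesis
        using v(1) assms(2) by (simp add: reflection_alpha_self opr_uminus reduced_def in_lists_conv_set subset_iff)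
    qed
    ultimately show ?thesis
      by simp
  qed
qed

text \<open>Since no letter repeats, each reflection meets a nonnegative vector whose coordinate at
  that letter is still 0, and the off-diagonal entries of the form are nonpositive; so this
  coordinate can only rise. If none rises, the vector stays \<open>alpha a\<close> and every pairing
  with it is 0.\<close>

lemma opr_alpha_distinct:
  assumes "a \<in> gens W" "set u \<subseteq> gens W" "distinct u" "a \<notin> set u"
  shows "0 \<le> opr u (alpha a) r"
    and "(\<And>z. z \<in> set u \<Longrightarrow> opr u (alpha a) z = 0) \<Longrightarrow> z \<in> set u \<Longrightarrow> gram z a = 0"
proof -
  have "(\<forall>r. 0 \<le> opr u (alpha a) r) \<and>
    ((\<forall>z\<in>set u. opr u (alpha a) z = 0) \<longrightarrow> (\<forall>z\<in>set u. gram z a = 0))"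
    using assms(2-)
  proof (induction u)
    case (Cons z u)
    let ?v = "opr u (alpha a)"
    have IH: "\<And>r. 0 \<le> ?v r" "(\<forall>z\<in>set u. ?v z = 0) \<longrightarrow> (\<forall>z\<in>set u. gram z a = 0)"
      using Cons by auto
    have z: "z \<in> gens W" "z \<noteq> a" "?v z = 0"
      using Cons.prems opr_outside[of u z "alpha a"] by (auto simp: alpha_apply)
    have "pairing z ?v \<le> 0"
      unfolding pairing_def
    proof (rule sum_nonpos)
      fix t assume "t \<in> gens W"
      then show "gram z t * ?v t \<le> 0"
        using IH(1)[of t] gram_nonpos[of z t] z by (cases "t = z") (auto simp: mult_nonpos_nonneg)
    qed
    then have "\<forall>r. 0 \<le> opr (z # u) (alpha a) r"
      using IH(1) z by (auto simp: reflection_apply intro: order_trans)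
    moreover have "\<forall>y\<in>set (z # u). gram y a = 0" if "\<forall>y\<in>set (z # u). opr (z # u) (alpha a) y = 0"
    proof -
      have "\<forall>y\<in>set u. ?v y = 0"
        using that z Cons.prems by (auto simp: reflection_apply split: if_splits)
      moreover from this have "?v = alpha a"
        using Cons.prems opr_outside[of u _ "alpha a"] by (auto simp: fun_eq_iff alpha_apply)
      ultimately show ?thesis
        using that z IH(2) assms(1) by (auto simp: reflection_apply pairing_alpha alpha_apply)
    qed
    ultimately show ?case
      by blast
  qed (simp add: alpha_apply)
  then show "0 \<le> opr u (alpha a) r"
    and "(\<And>z. z \<in> set u \<Longrightarrow> opr u (alpha a) z = 0) \<Longrightarrow> z \<in> set u \<Longrightarrow> gram z a = 0"
    by blast+
qed

lemma reflection_commute: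
  assumes "a \<in> gens W" "b \<in> gens W" "gram a b = 0"
  shows "reflection W a (reflection W b v) = reflection W b (reflection W a v)"
  using assms gram_sym[of a b]
  by (auto simp: fun_eq_iff reflection_apply pairing_reflection)

lemma reflection_opr_commute:
  assumes "a \<in> gens W" "set u \<subseteq> gens W" "\<And>z. z \<in> set u \<Longrightarrow> gram z a = 0"
  shows "reflection W a (opr u v) = opr u (reflection W a v)"
  using assms
proof (induction u)
  case (Cons z u)
  then have "reflection W a (reflection W z (opr u v)) = reflection W z (reflection W a (opr u v))"
    using gram_sym[of a z] by (intro reflection_commute) auto
  then show ?case
    using Cons by simp
qed simp

end

section \<open>The order of the letters in a word\<close>

definition precedes :: "'a list \<Rightarrow> 'a \<Rightarrow> 'a \<Rightarrow> bool" where
  "precedes xs a b \<longleftrightarrow> (\<exists>us vs. xs = us @ vs \<and> a \<in> set us \<and> b \<in> set vs)"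

text \<open>The index form is the one occurring in \<open>arrows\<close>; the definition by
  splitting is the one suited to concatenation.\<close>

lemma precedes_iff_nth:
  "precedes xs a b \<longleftrightarrow> (\<exists>i j. i < j \<and> j < length xs \<and> xs ! i = a \<and> xs ! j = b)"
proof
  assume "precedes xs a b"
  then obtain us vs i j where "xs = us @ vs" "i < length us" "us ! i = a" "j < length vs" "vs ! j = b"
    by (auto simp: precedes_def in_set_conv_nth)
  then show "\<exists>i j. i < j \<and> j < length xs \<and> xs ! i = a \<and> xs ! j = b"
    by (intro exI[of _ i] exI[of _ "length us + j"]) (auto simp: nth_append)
next
  assume "\<exists>i j. i < j \<and> j < length xs \<and> xs ! i = a \<and> xs ! j = b"
  then obtain i j where ij: "i < j" "j < length xs" "xs ! i = a" "xs ! j = b"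
    by blast
  then have "a \<in> set (take j xs)" "b \<in> set (drop j xs)"
    using nth_mem[of i "take j xs"] nth_mem[of 0 "drop j xs"] by auto
  then show "precedes xs a b"
    unfolding precedes_def by (metis append_take_drop_id)
qed

lemma precedes_append:
  "precedes (xs @ ys) a b \<longleftrightarrow> precedes xs a b \<or> precedes ys a b \<or> (a \<in> set xs \<and> b \<in> set ys)"
proof
  assume "precedes (xs @ ys) a b"
  then obtain us vs where "xs @ ys = us @ vs" and ab: "a \<in> set us" "b \<in> set vs"
    by (auto simp: precedes_def)
  then obtain zs where "xs = us @ zs \<and> vs = zs @ ys \<or> us = xs @ zs \<and> ys = zs @ vs"
    by (auto simp: append_eq_append_conv2)
  then show "precedes xs a b \<or> precedes ys a b \<or> (a \<in> set xs \<and> b \<in> set ys)"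
    using ab unfolding precedes_def by (elim disjE) auto
next
  assume "precedes xs a b \<or> precedes ys a b \<or> (a \<in> set xs \<and> b \<in> set ys)"
  then consider us vs where "xs = us @ vs" "a \<in> set us" "b \<in> set vs"
    | us vs where "ys = us @ vs" "a \<in> set us" "b \<in> set vs"
    | "a \<in> set xs" "b \<in> set ys"
    by (auto simp: precedes_def)
  then show "precedes (xs @ ys) a b"
  proof cases
    case (1 us vs)
    then show ?thesis
      unfolding precedes_def by (intro exI[of _ us] exI[of _ "vs @ ys"]) auto
  next
    case (2 us vs)
    then show ?thesis
      unfolding precedes_def by (intro exI[of _ "xs @ us"] exI[of _ vs]) auto
  qed (auto simp: precedes_def)
qed

lemma not_precedes_Nil [simp]: "\<not> precedes [] a b"
  by (simp add: precedes_def)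

lemma not_precedes_singleton [simp]: "\<not> precedes [x] a b"
  by (auto simp: precedes_iff_nth)

context coxeter_geometry
begin

text \<open>The last letter \<open>a\<close> of \<open>ss\<close> makes the operator send \<open>alpha a\<close> to a nonpositive vector. This
  forces all letters of \<open>tt\<close> to the right of \<open>a\<close> to commute with \<open>a\<close>, so \<open>a\<close> can be cancelled.\<close>

lemma precedes_unique:
  assumes "distinct ss" "distinct tt" "set ss = set tt" "set ss \<subseteq> gens W" "opr ss = opr tt"
    and "gram a b \<noteq> 0" "precedes ss a b"
  shows "precedes tt a b"
  using assms
proof (induction ss arbitrary: tt rule: rev_induct)
  case (snoc x ss)
  then obtain ts us where tt: "tt = ts @ x # us"
    by (metis in_set_conv_decomp in_set_conv_decomp_first rotate1.simps(2) set_rotate1 list.set_intros(1))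
  have x: "x \<in> gens W" and subsets: "set ss \<subseteq> gens W" "set ts \<subseteq> gens W" "set us \<subseteq> gens W"
    using snoc.prems(3,4) tt by auto
  have dist: "distinct ss" "x \<notin> set ss" "distinct us" "x \<notin> set us" "set ts \<inter> set us = {}"
      "distinct (ts @ us)" "x \<notin> set ts"
    using snoc.prems(1,2) tt by auto
  have sets: "set ss = set ts \<union> set us"
    using snoc.prems(1-3) tt by auto
  have "opr (ss @ [x]) (alpha x) = - opr ss (alpha x)"
    using x subsets by (simp add: reflection_alpha_self opr_uminus)
  \<comment> \<open>In \<open>ss @ [x]\<close> the letter \<open>x\<close> acts first and negates
    \<open>alpha x\<close>; the remaining letters are distinct and differ from
    \<open>x\<close>.\<close>
  then have nonpos: "opr tt (alpha x) r \<le> 0" for r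
    using opr_alpha_distinct(1)[OF x subsets(1) dist(1,2), of r] snoc.prems(5) by (metis fun_Compl_def neg_le_0_iff_le)
  \<comment> \<open>The letters to the left of \<open>us\<close> differ from \<open>z\<close> and
    leave this coordinate alone, so it is both nonnegative and nonpositive.\<close>
  have "opr us (alpha x) z = 0" if "z \<in> set us" for z
  proof -
    have "z \<notin> set ts" "z \<noteq> x"
      using that dist by auto
    then have "opr tt (alpha x) z = opr us (alpha x) z"
      unfolding tt using x subsets opr_outside[OF subsets(2), of z] by (simp add: reflection_apply)
    then show ?thesis
      using nonpos[of z] opr_alpha_distinct(1)[OF x subsets(3) dist(3,4), of z] by simp
  qed
  then have commute: "gram z x = 0" if "z \<in> set us" for z
    using opr_alpha_distinct(2)[OF x subsets(3) dist(3,4)] that by blast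
  have "opr ss = opr (ts @ us)"
  proof
    fix v
    have "opr ss v = opr (ss @ [x]) (reflection W x v)"
      using x by simp
    also have "\<dots> = opr ts (reflection W x (opr us (reflection W x v)))"
      unfolding snoc.prems(5) by (simp add: tt)
    also have "\<dots> = opr (ts @ us) v"
      using reflection_opr_commute[OF x subsets(3) commute, of "reflection W x v"] x by simp
    finally show "opr ss v = opr (ts @ us) v" .
  qed
  then have IH: "precedes ss a b \<Longrightarrow> precedes (ts @ us) a b"
    using snoc.IH[of "ts @ us"] snoc.prems(6) subsets(1) dist(1,6) sets by simp
  consider "precedes ss a b" | "a \<in> set ss" "b = x"
    using snoc.prems(7) by (auto simp: precedes_append)
  then show ?case
  proof cases
    case 1
    then show ?thesis
      using IH precedes_append[of "[x]" us] by (auto simp: tt precedes_append)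
  next
    case 2
    \<comment> \<open>The letters of \<open>us\<close> are orthogonal to \<open>x\<close>, while
      \<open>a\<close> is not.\<close>
    then have "a \<in> set ts"
      using commute snoc.prems(6) sets by auto
    then show ?thesis
      using 2 by (simp add: tt precedes_append)
  qed
qed simp

section \<open>Action of the group and products of words\<close>

lemma word_cong_opr: "(u, v) \<in> word_cong (gens W) (coxeter_relations (gens W) (cox_mat W)) \<Longrightarrow> opr u = opr v"
proof (induction rule: word_cong.induct)
  case (base u v)
  then obtain s t k where st: "s \<in> gens W" "t \<in> gens W" "cox_mat W s t = enat k"
    and uv: "u = concat (replicate k [s, t])" "v = []"
    by (auto simp: coxeter_relations_def)
  show ?case
  proof (cases "s = t")
    case True
    then have "k = 1"
      using st matrix by (auto simp: coxeter_matrix_def one_enat_def)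
    then show ?thesis
      using True uv st by (auto simp: fun_eq_iff)
  next
    case False
    then show ?thesis
      using opr_braid[OF st(1,2) False st(3)] uv by (auto simp: concat_replicate_alternating fun_eq_iff)
  qed
qed auto

text \<open>The word chosen inside \<open>act\<close> is congruent to \<open>u\<close> by the
  presentation, and congruent words have the same operator.\<close>

lemma act_word_prod:
  assumes "u \<in> lists (gens W)"
  shows "act W (word_prod W u) = opr u"
proof -
  define ss where "ss = (SOME ss. ss \<in> lists (gens W) \<and> word_prod W ss = word_prod W u)"
  have "ss \<in> lists (gens W) \<and> word_prod W ss = word_prod W u"
    unfolding ss_def by (rule someI[of _ u]) (use assms in simp)
  then have "(ss, u) \<in> word_cong (gens W) (coxeter_relations (gens W) (cox_mat W))"
    using system assms unfolding coxeter_system_def by blast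
  then show ?thesis
    using word_cong_opr by (simp add: act_def ss_def[symmetric])
qed

lemma group_W: "group W"
  using system by (simp add: coxeter_system_def)

lemma gens_carrier: "gens W \<subseteq> carrier W"
  using system by (simp add: coxeter_system_def)

lemma word_prod_closed [simp]: "u \<in> lists (gens W) \<Longrightarrow> word_prod W u \<in> carrier W"
proof (induction u)
  case (Cons x u)
  then show ?case
    using gens_carrier group.is_monoid[OF group_W] by (auto simp: word_prod_def intro!: monoid.m_closed)
qed (use group.is_monoid[OF group_W] in \<open>auto simp: word_prod_def intro: monoid.one_closed\<close>)

lemma word_prod_append:
  assumes "u \<in> lists (gens W)" "v \<in> lists (gens W)"
  shows "word_prod W (u @ v) = word_prod W u \<otimes>\<^bsub>W\<^esub> word_prod W v"
proof -
  interpret group W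
    by (rule group_W)
  show ?thesis
    using assms
  proof (induction u)
    case Nil
    then show ?case
      using word_prod_closed[of v] by (simp add: word_prod_def)
  next
    case (Cons x u)
    then show ?case
      using gens_carrier word_prod_closed[of u] word_prod_closed[of v]
      by (auto simp: word_prod_def m_assoc subset_iff)
  qed
qed

lemma word_prod_eqI:
  assumes "u \<in> lists (gens W)" "v \<in> lists (gens W)"
    and "(u, v) \<in> word_cong (gens W) (coxeter_relations (gens W) (cox_mat W))"
  shows "word_prod W u = word_prod W v"
  using system assms by (simp add: coxeter_system_def)

lemma word_prod_square:
  assumes "s \<in> gens W"
  shows "word_prod W [s, s] = \<one>\<^bsub>W\<^esub>"
proof -
  have "word_prod W [s, s] = word_prod W []"
  proof (rule word_prod_eqI)
    have "([s, s], []) \<in> coxeter_relations (gens W) (cox_mat W)"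
      using assms matrix unfolding coxeter_relations_def coxeter_matrix_def
      by (auto intro!: exI[of _ s] exI[of _ "1::nat"] simp: one_enat_def)
    then show "([s, s], []) \<in> word_cong (gens W) (coxeter_relations (gens W) (cox_mat W))"
      using assms by (intro word_cong.base) auto
  qed (use assms in auto)
  then show ?thesis
    by (simp add: word_prod_def)
qed

lemma inv_word_prod:
  assumes "u \<in> lists (gens W)"
  shows "inv\<^bsub>W\<^esub> (word_prod W u) = word_prod W (rev u)"
proof -
  interpret group W
    by (rule group_W)
  have "word_prod W (rev u @ u) = \<one>\<^bsub>W\<^esub>"
    using assms
  proof (induction u)
    case (Cons x u)
    then have lists: "rev u \<in> lists (gens W)" "u \<in> lists (gens W)" "[x, x] \<in> lists (gens W)"
      by auto
    then have "word_prod W (rev u @ [x, x] @ u) = word_prod W (rev u @ u)"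
      using word_prod_append[of "rev u" "[x, x] @ u"] word_prod_append[of "rev u" u]
        word_prod_append[of "[x, x]" u] word_prod_square[of x] Cons.prems by simp
    then show ?case
      using Cons by simp
  qed (simp add: word_prod_def)
  then have "word_prod W (rev u) \<otimes>\<^bsub>W\<^esub> word_prod W u = \<one>\<^bsub>W\<^esub>"
    using word_prod_append[of "rev u" u] assms by (simp add: in_lists_conv_set)
  then show ?thesis
    using assms by (intro inv_equality) (auto simp: in_lists_conv_set)
qed

text \<open>The matrix entry is 2, so \<open>s t\<close> is its own inverse; on the other hand,
  reversing a word inverts its product.\<close>

lemma word_prod_commute:
  assumes "s \<in> gens W" "t \<in> gens W" "s \<noteq> t" "\<not> 2 < cox_mat W s t"
  shows "word_prod W [s, t] = word_prod W [t, s]"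
proof -
  interpret group W
    by (rule group_W)
  have m: "cox_mat W s t = enat 2"
    using assms matrix by (auto simp: coxeter_matrix_def numeral_eq_enat not_less intro: antisym)
  have "word_prod W ([s, t] @ [s, t]) = word_prod W []"
  proof (rule word_prod_eqI)
    have "([s, t] @ [s, t], []) \<in> coxeter_relations (gens W) (cox_mat W)"
      using assms m unfolding coxeter_relations_def
      by (intro CollectI exI[of _ s] exI[of _ t] exI[of _ 2]) (simp add: numeral_2_eq_2)
    then show "([s, t] @ [s, t], []) \<in> word_cong (gens W) (coxeter_relations (gens W) (cox_mat W))"
      using assms by (intro word_cong.base) auto
  qed (use assms in auto)
  then have "word_prod W [s, t] \<otimes>\<^bsub>W\<^esub> word_prod W [s, t] = \<one>\<^bsub>W\<^esub>"
    using word_prod_append[of "[s, t]" "[s, t]"] assms by (simp add: word_prod_def)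
  then have "inv\<^bsub>W\<^esub> (word_prod W [s, t]) = word_prod W [s, t]"
    using assms by (intro inv_equality) auto
  then show ?thesis
    using inv_word_prod[of "[s, t]"] assms by simp
qed

end

section \<open>The graph monoid and admissible words\<close>

lemma word_cong_lists: "(u, v) \<in> word_cong A R \<Longrightarrow> u \<in> lists A \<and> v \<in> lists A"
  by (induction rule: word_cong.induct) auto

lemma equiv_word_cong: "equiv (lists A) (word_cong A R)"
  by (auto simp: equiv_def sym_def intro!: refl_onI transI
      dest: word_cong_lists intro: word_cong.refl word_cong.sym word_cong.trans)

lemma word_cong_append:
  assumes "(u, u') \<in> word_cong A R" "(v, v') \<in> word_cong A R"
  shows "(u @ v, u' @ v') \<in> word_cong A R"
proof -
  have "([] @ u @ v, [] @ u' @ v) \<in> word_cong A R"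
    using assms word_cong_lists by (intro word_cong.mult) blast+
  moreover have "(u' @ v @ [], u' @ v' @ []) \<in> word_cong A R"
    using assms word_cong_lists by (intro word_cong.mult) blast+
  ultimately show ?thesis
    by (auto intro: word_cong.trans)
qed

text \<open>An arrow from \<open>x\<close> to \<open>y\<close> keeps \<open>x\<close> from being a
  sink and is reversed only when one of its ends occurs; so \<open>y\<close> must occur before
  \<open>x\<close> can.\<close>

lemma sink_sequence_closed:
  assumes "sink_sequence R xs" "x \<in> set xs" "(x, y) \<in> R"
  shows "y \<in> set xs"
  using assms by (induction xs arbitrary: R) (auto simp: sink_def reverse_at_def)

text \<open>Describes repetition-free sink sequences without changing the orientation:
  \<open>D\<close> records the vertices already used, and a new vertex is a sink at its turn iff all
  its arrows in the original \<open>R\<close> lead into \<open>D\<close>.\<close>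

fun topological_from :: "('v \<times> 'v) set \<Rightarrow> 'v set \<Rightarrow> 'v list \<Rightarrow> bool" where
  "topological_from R D [] \<longleftrightarrow> True"
| "topological_from R D (z # zs) \<longleftrightarrow> z \<notin> D \<and> R `` {z} \<subseteq> D \<and> topological_from R (insert z D) zs"

lemma topological_from_append:
  "topological_from R D (xs @ ys) \<longleftrightarrow> topological_from R D xs \<and> topological_from R (D \<union> set xs) ys"
  by (induction xs arbitrary: D) auto

lemma topological_from_distinct: "topological_from R D zs \<Longrightarrow> distinct zs \<and> set zs \<inter> D = {}"
  by (induction zs arbitrary: D) auto

lemma topological_from_closed:
  "topological_from R D zs \<Longrightarrow> R `` D \<subseteq> D \<Longrightarrow> R `` (D \<union> set zs) \<subseteq> D \<union> set zs"
proof (induction zs arbitrary: D)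
  case (Cons z zs)
  then have "R `` insert z D \<subseteq> insert z D"
    by auto
  then have "R `` (insert z D \<union> set zs) \<subseteq> insert z D \<union> set zs"
    using Cons.prems(1) by (intro Cons.IH) simp_all
  then show ?case
    by simp
qed simp

text \<open>Arrows of a kept vertex lead to vertices satisfying \<open>P\<close> again, so no
  required predecessor in the list is dropped. This cuts an ordering of all vertices down to an
  up-set.\<close>

lemma topological_from_filter:
  assumes "topological_from R D zs" "\<And>z. P z \<Longrightarrow> R `` {z} \<subseteq> Collect P"
  shows "topological_from R (D \<inter> Collect P) (filter P zs)"
  using assms(1)
proof (induction zs arbitrary: D)
  case (Cons z zs)
  then have "topological_from R (insert z D \<inter> Collect P) (filter P zs)"
    by simp
  moreover have "insert z D \<inter> Collect P = (if P z then insert z (D \<inter> Collect P) else D \<inter> Collect P)"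
    by auto
  ultimately show ?case
    using Cons.prems assms(2)[of z] by auto
qed simp

text \<open>\<open>R'\<close> stands for the current orientation after the vertices of
  \<open>D\<close> have been used.\<close>

lemma sink_sequence_iff_topological_from:
  assumes "\<And>z. z \<notin> D \<Longrightarrow> R' `` {z} = R `` {z} - D"
  shows "sink_sequence R' zs \<and> distinct zs \<and> set zs \<inter> D = {} \<longleftrightarrow> topological_from R D zs"
  using assms
proof (induction zs arbitrary: R' D)
  case (Cons z zs)
  show ?case
  proof (cases "z \<notin> D \<and> R `` {z} \<subseteq> D")
    case True
    then have sink: "sink R' z"
      using Cons.prems[of z] by (auto simp: sink_def)
    have "reverse_at z R' `` {y} = R `` {y} - insert z D" if "y \<notin> insert z D" for y
      using Cons.prems[of y] sink that by (auto simp: sink_def reverse_at_def)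
    then have "sink_sequence (reverse_at z R') zs \<and> distinct zs \<and> set zs \<inter> insert z D = {} \<longleftrightarrow>
        topological_from R (insert z D) zs"
      by (rule Cons.IH)
    then show ?thesis
      using True sink by auto
  next
    case False
    then have "z \<in> D \<or> \<not> sink R' z"
      using Cons.prems[of z] by (auto simp: sink_def)
    then show ?thesis
      using False by auto
  qed
qed simp

lemma sink_sequence_distinct_iff: "sink_sequence R zs \<and> distinct zs \<longleftrightarrow> topological_from R {} zs"
  using sink_sequence_iff_topological_from[of "{}" R R zs] by simp

lemma reverse_at_symclosure: "reverse_at z R \<union> (reverse_at z R)\<inverse> = R \<union> R\<inverse>"
  by (auto simp: reverse_at_def)

lemma reverse_at_commute: "x \<noteq> y \<Longrightarrow> reverse_at x (reverse_at y R) = reverse_at y (reverse_at x R)"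
  by (auto simp: reverse_at_def)

lemma is_path_snoc: "is_path R x (p @ [a]) y \<longleftrightarrow> is_path R x p (fst a) \<and> a \<in> R \<and> snd a = y"
  by (induction p arbitrary: x) auto

lemma is_path_rtrancl: "is_path R x p y \<Longrightarrow> (x, y) \<in> R\<^sup>*"
proof (induction p arbitrary: x)
  case (Cons a p)
  then have "(x, snd a) \<in> R" "(snd a, y) \<in> R\<^sup>*"
    by auto
  then show ?case
    by (rule converse_rtrancl_into_rtrancl)
qed simp

lemma precedes_map_inj:
  assumes "inj_on f A" "set xs \<subseteq> A" "a \<in> A" "b \<in> A"
  shows "precedes (map f xs) (f a) (f b) \<longleftrightarrow> precedes xs a b"
proof
  assume "precedes (map f xs) (f a) (f b)"
  then obtain i j where ij: "i < j" "j < length xs" "f (xs ! i) = f a" "f (xs ! j) = f b"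
    by (auto simp: precedes_iff_nth)
  moreover have "xs ! i \<in> A" "xs ! j \<in> A"
    using ij assms(2) by (auto simp: subset_iff)
  ultimately have "xs ! i = a" "xs ! j = b"
    using assms by (auto dest: inj_onD)
  then show "precedes xs a b"
    using ij by (auto simp: precedes_iff_nth)
next
  assume "precedes xs a b"
  then show "precedes (map f xs) (f a) (f b)"
    unfolding precedes_iff_nth by (metis length_map less_trans nth_map)
qed

lemma wf_precedes:
  assumes "distinct xs"
  shows "wf {(x, y). precedes xs x y}"
proof (rule wf_subset)
  let ?f = "the_inv_into {..<length xs} ((!) xs)"
  have "inj_on ((!) xs) {..<length xs}"
    using assms by (auto simp: inj_on_nth)
  then show "{(x, y). precedes xs x y} \<subseteq> measure ?f"
    by (auto simp: precedes_iff_nth the_inv_into_f_f)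
qed simp

section \<open>The graph monoid computed on representing words\<close>

locale labelled_coxeter = coxeter_geometry W for W :: "('w, 'v) coxeter_data" +
  assumes bij_rho: "bij_betw (rho W) (verts W) (gens W)"
begin

lemma rho_image: "rho W ` verts W = gens W"
  using bij_rho by (simp add: bij_betw_def)

lemma rho_gens [simp]: "x \<in> verts W \<Longrightarrow> rho W x \<in> gens W"
  using bij_rho by (auto simp: bij_betw_def)

lemma inj_rho: "inj_on (rho W) (verts W)"
  using bij_rho by (simp add: bij_betw_def)

lemma rho_eq_iff [simp]: "x \<in> verts W \<Longrightarrow> y \<in> verts W \<Longrightarrow> rho W x = rho W y \<longleftrightarrow> x = y"
  using inj_rho by (auto dest: inj_onD)

lemma finite_verts: "finite (verts W)"
  using bij_rho finite_gens bij_betw_finite by blast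

lemma map_rho_lists [simp]: "u \<in> lists (verts W) \<Longrightarrow> map (rho W) u \<in> lists (gens W)"
  by auto

lemma rho_image_subset [simp]: "A \<subseteq> verts W \<Longrightarrow> rho W ` A \<subseteq> gens W"
  by auto

lemma map_rho_subset: "set u \<subseteq> verts W \<Longrightarrow> set (map (rho W) u) \<subseteq> gens W"
  by auto

abbreviation vopr :: "'v list \<Rightarrow> ('w \<Rightarrow> real) \<Rightarrow> 'w \<Rightarrow> real" where
  "vopr u \<equiv> opr (map (rho W) u)"

lemma edges_sym: "(x, y) \<in> edges W \<Longrightarrow> (y, x) \<in> edges W"
  using matrix by (auto simp: edges_def coxeter_matrix_def)

lemma gram_edges:
  assumes "x \<in> verts W" "y \<in> verts W" "x \<noteq> y"
  shows "gram (rho W x) (rho W y) = 0 \<longleftrightarrow> (x, y) \<notin> edges W"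
  using assms by (simp add: gram_eq_0_iff edges_def)

lemma graph_cong_lists: "(u, v) \<in> graph_cong W \<Longrightarrow> u \<in> lists (verts W) \<and> v \<in> lists (verts W)"
  unfolding graph_cong_def by (rule word_cong_lists)

lemma equiv_graph_cong: "equiv (lists (verts W)) (graph_cong W)"
  unfolding graph_cong_def by (rule equiv_word_cong)

lemma graph_cong_refl: "u \<in> lists (verts W) \<Longrightarrow> (u, u) \<in> graph_cong W"
  unfolding graph_cong_def by (rule word_cong.refl)

lemma graph_cong_sym: "(u, v) \<in> graph_cong W \<Longrightarrow> (v, u) \<in> graph_cong W"
  unfolding graph_cong_def by (rule word_cong.sym)

lemma graph_cong_trans: "(u, v) \<in> graph_cong W \<Longrightarrow> (v, w) \<in> graph_cong W \<Longrightarrow> (u, w) \<in> graph_cong W"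
  unfolding graph_cong_def by (rule word_cong.trans)

lemma graph_cong_append:
  "(u, u') \<in> graph_cong W \<Longrightarrow> (v, v') \<in> graph_cong W \<Longrightarrow> (u @ v, u' @ v') \<in> graph_cong W"
  unfolding graph_cong_def by (rule word_cong_append)

lemma graph_cong_commute:
  assumes "x \<in> verts W" "y \<in> verts W" "x \<noteq> y" "(x, y) \<notin> edges W"
  shows "([x, y], [y, x]) \<in> graph_cong W"
  unfolding graph_cong_def using assms by (intro word_cong.base) auto

lemma graph_cong_mset: "(u, v) \<in> graph_cong W \<Longrightarrow> mset u = mset v"
  unfolding graph_cong_def by (induction rule: word_cong.induct) auto

lemma graph_cong_rev: "(u, v) \<in> graph_cong W \<Longrightarrow> (rev u, rev v) \<in> graph_cong W"
  unfolding graph_cong_def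
proof (induction rule: word_cong.induct)
  case (base u v)
  then obtain x y where xy: "u = [x, y]" "v = [y, x]" "x \<in> verts W" "y \<in> verts W" "x \<noteq> y" "(x, y) \<notin> edges W"
    by auto
  then show ?case
    using graph_cong_sym[OF graph_cong_commute[of x y]] by (simp add: graph_cong_def)
next
  case (mult u v a b)
  then have "rev a \<in> lists (verts W)" "rev b \<in> lists (verts W)"
    by auto
  then have "(rev b @ rev u @ rev a, rev b @ rev v @ rev a) \<in> word_cong (verts W)
      {([v, w], [w, v]) |v w. v \<in> verts W \<and> w \<in> verts W \<and> v \<noteq> w \<and> (v, w) \<notin> edges W}"
    using mult.IH by (intro word_cong.mult)
  then show ?case
    by simp
qed (auto intro: word_cong.refl word_cong.sym word_cong.trans)

lemma graph_cong_word_prod: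
  "(u, v) \<in> graph_cong W \<Longrightarrow> word_prod W (map (rho W) u) = word_prod W (map (rho W) v)"
  unfolding graph_cong_def
proof (induction rule: word_cong.induct)
  case (base u v)
  then obtain x y where "u = [x, y]" "v = [y, x]" "x \<in> verts W" "y \<in> verts W" "x \<noteq> y" "(x, y) \<notin> edges W"
    by auto
  then show ?case
    using word_prod_commute[of "rho W x" "rho W y"] by (simp add: edges_def)
next
  case (mult u v a b)
  then have "u \<in> lists (verts W)" "v \<in> lists (verts W)"
    using word_cong_lists by blast+
  then show ?case
    using mult by (simp add: word_prod_append)
qed auto

lemma word_class_eq_iff:
  assumes "u \<in> lists (verts W)" "v \<in> lists (verts W)"
  shows "word_class W u = word_class W v \<longleftrightarrow> (u, v) \<in> graph_cong W"
  unfolding word_class_def by (rule eq_equiv_class_iff[OF equiv_graph_cong assms])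

lemma in_word_class [simp]: "u \<in> lists (verts W) \<Longrightarrow> u \<in> word_class W u"
  by (simp add: word_class_def graph_cong_refl)

lemma word_class_mset: "v \<in> word_class W u \<Longrightarrow> mset v = mset u"
  by (metis ImageE graph_cong_mset singletonD word_class_def)

lemma Supp_word_class:
  assumes "u \<in> lists (verts W)"
  shows "Supp (word_class W u) = set u"
proof -
  have "set v = set u" if "v \<in> word_class W u" for v
    using word_class_mset[OF that] by (rule mset_eq_setD)
  then show ?thesis
    using in_word_class[OF assms] unfolding Supp_def by blast
qed

lemma mult_free_word_class:
  assumes "u \<in> lists (verts W)"
  shows "mult_free (word_class W u) \<longleftrightarrow> distinct u"
proof
  assume "mult_free (word_class W u)"
  then show "distinct u"
    using in_word_class[OF assms] by (simp add: mult_free_def)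
next
  assume "distinct u"
  then show "mult_free (word_class W u)"
    unfolding mult_free_def using mset_eq_imp_distinct_iff[OF word_class_mset] by blast
qed

lemma word_transp_word_class:
  assumes "u \<in> lists (verts W)"
  shows "word_transp (word_class W u) = word_class W (rev u)"
proof -
  have "v \<in> rev ` word_class W u" if "v \<in> word_class W (rev u)" for v
    using that graph_cong_rev[of "rev u" v] by (intro image_eqI[of _ _ "rev v"]) (auto simp: word_class_def)
  then show ?thesis
    using graph_cong_rev by (auto simp: word_transp_def word_class_def)
qed

lemma rho_monoid_word_class:
  assumes "u \<in> lists (verts W)"
  shows "rho_monoid W (word_class W u) = word_prod W (map (rho W) u)"
proof -
  have "(\<lambda>u. word_prod W (map (rho W) u)) ` word_class W u = {word_prod W (map (rho W) u)}"
  proof (intro equalityI subsetI)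
    fix w assume "w \<in> (\<lambda>u. word_prod W (map (rho W) u)) ` word_class W u"
    then obtain v where "w = word_prod W (map (rho W) v)" "(u, v) \<in> graph_cong W"
      by (auto simp: word_class_def)
    then show "w \<in> {word_prod W (map (rho W) u)}"
      using graph_cong_word_prod[of u v] by simp
  next
    fix w assume "w \<in> {word_prod W (map (rho W) u)}"
    then show "w \<in> (\<lambda>u. word_prod W (map (rho W) u)) ` word_class W u"
      using in_word_class[OF assms] by blast
  qed
  then show ?thesis
    by (simp add: rho_monoid_def)
qed

lemma act_rho_monoid:
  assumes "u \<in> lists (verts W)"
  shows "act W (rho_monoid W (word_class W u)) = vopr u"
  using assms by (simp only: rho_monoid_word_class act_word_prod map_rho_lists)

lemma graph_monoid_mult:
  assumes "u \<in> lists (verts W)" "v \<in> lists (verts W)"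
  shows "word_class W u \<otimes>\<^bsub>graph_monoid W\<^esub> word_class W v = word_class W (u @ v)"
proof -
  have "word_class W (u' @ v') = word_class W (u @ v)" if "u' \<in> word_class W u" "v' \<in> word_class W v" for u' v'
  proof -
    have "(u @ v, u' @ v') \<in> graph_cong W"
      using that by (intro graph_cong_append) (auto simp: word_class_def)
    then show ?thesis
      using graph_cong_lists[of "u @ v" "u' @ v'"] word_class_eq_iff[of "u @ v" "u' @ v'"] by simp
  qed
  then have "(\<Union>u'\<in>word_class W u. \<Union>v'\<in>word_class W v. word_class W (u' @ v')) = word_class W (u @ v)"
    by (intro UN_constant_eq[OF in_word_class[OF assms(1)]] UN_constant_eq[OF in_word_class[OF assms(2)]] ballI)
  then show ?thesis
    by (simp add: graph_monoid_def)
qed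

lemma preceq_iff:
  assumes "u \<in> lists (verts W)" "v \<in> lists (verts W)"
  shows "preceq W (word_class W v) (word_class W u) \<longleftrightarrow>
    (\<exists>w\<in>lists (verts W). (u, w @ v) \<in> graph_cong W)"
proof -
  have carrier: "carrier (graph_monoid W) = word_class W ` lists (verts W)"
    by (auto simp: graph_monoid_def quotient_def word_class_def)
  have "word_class W u = word_class W w \<otimes>\<^bsub>graph_monoid W\<^esub> word_class W v \<longleftrightarrow> (u, w @ v) \<in> graph_cong W"
    if "w \<in> lists (verts W)" for w
    using that assms graph_monoid_mult[OF that assms(2)] word_class_eq_iff[OF assms(1), of "w @ v"] by simp
  then show ?thesis
    by (auto simp: preceq_def carrier)
qed

text \<open>Congruent words have equal length, so mutual divisibility forces the cofactors to be
  empty.\<close>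

lemma preceq_antisym:
  assumes "u \<in> lists (verts W)" "v \<in> lists (verts W)"
    and "preceq W (word_class W v) (word_class W u)" "preceq W (word_class W u) (word_class W v)"
  shows "word_class W u = word_class W v"
proof -
  obtain w w' where w: "(u, w @ v) \<in> graph_cong W" "(v, w' @ u) \<in> graph_cong W"
    using assms(3,4) preceq_iff[OF assms(1,2)] preceq_iff[OF assms(2,1)] by blast
  then have "length u = length w + length v" "length v = length w' + length u"
    using w[THEN graph_cong_mset] by (metis length_append size_mset, metis length_append size_mset)
  then have "w = []"
    by simp
  then show ?thesis
    using w(1) assms(1,2) by (simp add: word_class_eq_iff)
qed

text \<open>A neighbour of the sink \<open>z\<close> cannot become a sink before \<open>z\<close> occurs, so \<open>z\<close> commutes with all
  letters occurring before it.\<close>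

lemma sink_moves_first:
  assumes "R \<union> R\<inverse> = edges W" "sink_sequence R xs" "sink R z" "z \<in> set xs" "set xs \<subseteq> verts W"
  shows "\<exists>xs'. (rev xs, rev xs' @ [z]) \<in> graph_cong W \<and> sink_sequence (reverse_at z R) xs'"
  using assms
proof (induction xs arbitrary: R)
  case (Cons y ys)
  show ?case
  proof (cases "y = z")
    case True
    have "rev ys @ [z] \<in> lists (verts W)"
      using Cons.prems True by auto
    then show ?thesis
      using Cons.prems True graph_cong_refl by (intro exI[of _ ys]) simp
  next
    case False
    have nonadj: "(y, z) \<notin> R" "(z, y) \<notin> R"
      using Cons.prems(2,3) by (auto simp: sink_def)
    then have nonedge: "(z, y) \<notin> edges W" "(y, z) \<notin> edges W"
      using Cons.prems(1) by blast+
    have "sink (reverse_at y R) z"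
      using Cons.prems(3) nonadj False by (auto simp: sink_def reverse_at_def)
    then obtain ys' where ys': "(rev ys, rev ys' @ [z]) \<in> graph_cong W"
        "sink_sequence (reverse_at z (reverse_at y R)) ys'"
      using Cons.IH[of "reverse_at y R"] Cons.prems False by (auto simp: reverse_at_symclosure)
    have lists: "y \<in> verts W" "z \<in> verts W" "rev ys' \<in> lists (verts W)"
      using Cons.prems graph_cong_lists[OF ys'(1)] by auto
    have "(rev ys @ [y], (rev ys' @ [z]) @ [y]) \<in> graph_cong W"
      using ys'(1) lists by (intro graph_cong_append graph_cong_refl) auto
    moreover have "(rev ys' @ [z, y], rev ys' @ [y, z]) \<in> graph_cong W"
      using lists nonedge False by (intro graph_cong_append graph_cong_refl graph_cong_commute) auto
    ultimately have "(rev (y # ys), rev (y # ys') @ [z]) \<in> graph_cong W"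
      by (auto intro: graph_cong_trans)
    \<comment> \<open>In the new sequence \<open>y\<close> is used after \<open>z\<close>; not being
      adjacent to \<open>z\<close>, it is still a sink.\<close>
    moreover have "sink (reverse_at z R) y"
      using Cons.prems(2) nonadj False by (auto simp: sink_def reverse_at_def)
    ultimately show ?thesis
      using ys'(2) reverse_at_commute[of y z R] False by (intro exI[of _ "y # ys'"]) auto
  qed
qed simp

text \<open>Each letter of \<open>zs\<close> in turn is a sink occurring in the other sequence, so
  \<open>sink_moves_first\<close> brings it to the front, and both sequences continue in the same
  reversed orientation. As \<open>zs\<close> has no repetition, removing one letter loses none that
  is still needed.\<close>

lemma sink_sequence_prefix:
  assumes "R \<union> R\<inverse> = edges W" "sink_sequence R xs" "set xs \<subseteq> verts W"
    and "sink_sequence R zs" "distinct zs" "set zs \<subseteq> set xs"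
  shows "\<exists>w\<in>lists (verts W). (rev xs, w @ rev zs) \<in> graph_cong W"
  using assms
proof (induction zs arbitrary: R xs)
  case Nil
  then have "rev xs \<in> lists (verts W)"
    by auto
  then show ?case
    by (auto intro!: bexI[of _ "rev xs"] graph_cong_refl)
next
  case (Cons z zs)
  then obtain xs' where xs': "(rev xs, rev xs' @ [z]) \<in> graph_cong W" "sink_sequence (reverse_at z R) xs'"
    using sink_moves_first[of R xs z] by auto
  then have "set xs = insert z (set xs')"
    using mset_eq_setD[OF graph_cong_mset[OF xs'(1)]] by simp
  then have "\<exists>w\<in>lists (verts W). (rev xs', w @ rev zs) \<in> graph_cong W"
    using Cons.prems xs'(2) by (intro Cons.IH[of "reverse_at z R" xs']) (auto simp: reverse_at_symclosure)
  then obtain w where w: "w \<in> lists (verts W)" "(rev xs', w @ rev zs) \<in> graph_cong W"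
    by blast
  have "z \<in> verts W"
    using Cons.prems by auto
  then have "(rev xs' @ [z], (w @ rev zs) @ [z]) \<in> graph_cong W"
    using w by (intro graph_cong_append graph_cong_refl) auto
  then show ?case
    using w(1) xs'(1) by (auto intro!: bexI[of _ w] intro: graph_cong_trans)
qed

end

section \<open>Path sums\<close>

text \<open>One ordering of \<open>S\<close>, written in vertices, is fixed for \<open>c\<close>.
  Its reverse serves for the inverse of \<open>c\<close>, so each result is available for both
  Coxeter elements.\<close>

locale ordered_coxeter = labelled_coxeter W for W :: "('w, 'v) coxeter_data" +
  fixes c :: 'w and vs :: "'v list"
  assumes distinct_vs: "distinct vs" and set_vs: "set vs = verts W"
    and c_eq: "word_prod W (map (rho W) vs) = c"
begin

lemma vs_lists [simp]: "vs \<in> lists (verts W)"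
  using set_vs by auto

lemma cox_ordering_vs: "cox_ordering W c (map (rho W) vs)"
  using distinct_vs set_vs c_eq inj_rho bij_rho
  by (auto simp: cox_ordering_def distinct_map bij_betw_def)

lemma act_c: "act W c = vopr vs"
  using act_word_prod[of "map (rho W) vs"] c_eq by simp

text \<open>Two orderings with product \<open>c\<close> have the same operator, hence by
  \<open>precedes_unique\<close> the same relative order of adjacent vertices. So \<open>vs\<close>
  can stand for the quantifier over all orderings.\<close>

lemma arrows_eq: "arrows W c = {(x, y) \<in> edges W. precedes vs x y}"
proof -
  have "precedes vs x y" if "(x, y) \<in> edges W" "cox_ordering W c ss" "precedes ss (rho W x) (rho W y)" for x y ss
  proof -
    have xy: "x \<in> verts W" "y \<in> verts W" "x \<noteq> y"
      using that(1) by (auto simp: edges_def)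
    have ss: "distinct ss" "set ss = gens W" "word_prod W ss = c"
      using that(2) by (auto simp: cox_ordering_def)
    have "precedes (map (rho W) vs) (rho W x) (rho W y)"
    proof (rule precedes_unique[of ss])
      show "opr ss = vopr vs"
        using act_word_prod[of ss] ss(2,3) act_c by (simp add: lists_eq_set)
      show "distinct (map (rho W) vs)" "set ss = set (map (rho W) vs)"
        using cox_ordering_vs ss by (auto simp: cox_ordering_def)
      show "gram (rho W x) (rho W y) \<noteq> 0"
        using that(1) xy gram_edges by blast
    qed (use ss that(3) in auto)
    then show ?thesis
      using precedes_map_inj[OF inj_rho, of vs x y] set_vs xy by simp
  qed
  moreover have "precedes (map (rho W) vs) (rho W x) (rho W y)" if "precedes vs x y" "(x, y) \<in> edges W" for x y
    using that precedes_map_inj[OF inj_rho, of vs x y] set_vs by (simp add: edges_def)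
  moreover have "arrows W c = {(x, y) \<in> edges W. \<exists>ss. cox_ordering W c ss \<and> precedes ss (rho W x) (rho W y)}"
    unfolding arrows_def precedes_iff_nth by blast
  ultimately show ?thesis
    using cox_ordering_vs by blast
qed

lemma wf_arrows: "wf (arrows W c)"
  using wf_precedes[OF distinct_vs] by (rule wf_subset) (auto simp: arrows_eq)

lemma arrows_symclosure: "arrows W c \<union> (arrows W c)\<inverse> = edges W"
proof -
  have "precedes vs x y \<or> precedes vs y x" if "(x, y) \<in> edges W" for x y
  proof -
    have "x \<in> set vs" "y \<in> set vs" "x \<noteq> y"
      using that set_vs by (auto simp: edges_def)
    then show ?thesis
      by (metis in_set_conv_nth linorder_neqE_nat precedes_iff_nth)
  qed
  then show ?thesis
    using edges_sym by (auto simp: arrows_eq)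
qed

lemma arrows_verts: "(x, y) \<in> arrows W c \<Longrightarrow> x \<in> verts W \<and> y \<in> verts W"
  by (auto simp: arrows_eq edges_def)

lemma arrows_irrefl: "(x, x) \<notin> arrows W c"
  by (auto simp: arrows_eq edges_def)

lemma arrows_rtrancl_verts: "(x, y) \<in> (arrows W c)\<^sup>* \<Longrightarrow> x \<in> verts W \<Longrightarrow> y \<in> verts W"
  by (induction rule: rtrancl_induct) (auto dest: arrows_verts)

text \<open>Arrows lead from left to right in \<open>vs\<close>; read from its right end,
  \<open>vs\<close> therefore meets every vertex after all targets of its arrows.\<close>

lemma topological_split:
  assumes "vs = as @ x # bs"
  shows "topological_from (arrows W c) {} (rev bs @ [x])"
proof -
  have "topological_from (arrows W c) {} (rev ys)" if "vs = xs @ ys" for xs ys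
    using that
  proof (induction ys arbitrary: xs)
    case (Cons y ys)
    have "topological_from (arrows W c) {} (rev ys)"
      using Cons.prems by (intro Cons.IH[of "xs @ [y]"]) simp
    moreover have "arrows W c `` {y} \<subseteq> set ys"
    proof
      fix z assume "z \<in> arrows W c `` {y}"
      then have "precedes (xs @ [y] @ ys) y z"
        using Cons.prems by (simp add: arrows_eq)
      then show "z \<in> set ys"
        using distinct_vs Cons.prems by (auto simp: precedes_append) (auto simp: precedes_def Cons_eq_append_conv)
    qed
    ultimately show ?case
      using distinct_vs Cons.prems by (simp add: topological_from_append)
  qed simp
  from this[of as "x # bs"] show ?thesis
    using assms by simp
qed

definition path_sum :: "'v \<Rightarrow> 'v \<Rightarrow> real" where
  "path_sum x y = (\<Sum>p\<in>paths W c x y. path_value W p)"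

text \<open>The last arrow is split off because the coordinate at \<open>y\<close> arises from those
  at the predecessors of \<open>y\<close>; \<open>wf_arrows\<close> makes this a usable
  recursion.\<close>

lemma paths_rec:
  "paths W c x y = (if x = y then {[]} else {}) \<union>
    (\<Union>k\<in>(arrows W c)\<inverse> `` {y}. (\<lambda>p. p @ [(k, y)]) ` paths W c x k)"
proof (rule Set.set_eqI)
  fix p
  show "p \<in> paths W c x y \<longleftrightarrow> p \<in> (if x = y then {[]} else {}) \<union>
    (\<Union>k\<in>(arrows W c)\<inverse> `` {y}. (\<lambda>p. p @ [(k, y)]) ` paths W c x k)"
    by (cases p rule: rev_cases) (auto simp: paths_def is_path_snoc UN_iff intro!: bexI)
qed

lemma finite_predecessors: "finite ((arrows W c)\<inverse> `` {y})"
  using finite_verts by (rule finite_subset[rotated]) (auto dest: arrows_verts)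

lemma finite_paths: "finite (paths W c x y)"
  using wf_arrows
proof (induction y rule: wf_induct_rule)
  case (less y)
  then show ?case
    using finite_predecessors by (subst paths_rec) auto
qed

lemma path_value_snoc:
  assumes "(k, y) \<in> arrows W c"
  shows "path_value W (p @ [(k, y)]) = - gram (rho W y) (rho W k) * path_value W p"
  using arrows_verts[OF assms] by (simp add: path_value_def bform_alpha_left pairing_alpha)

lemma path_sum_rec:
  "path_sum x y = (if x = y then 1 else 0) +
    (\<Sum>k\<in>(arrows W c)\<inverse> `` {y}. - gram (rho W y) (rho W k) * path_sum x k)"
proof -
  have "path_sum x y = (\<Sum>p\<in>(if x = y then {[]} else {}). path_value W p) +
      (\<Sum>p\<in>(\<Union>k\<in>(arrows W c)\<inverse> `` {y}. (\<lambda>p. p @ [(k, y)]) ` paths W c x k). path_value W p)"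
    unfolding path_sum_def
    by (subst paths_rec, rule sum.union_disjoint) (use finite_predecessors finite_paths in auto)
  also have "(\<Sum>p\<in>(\<Union>k\<in>(arrows W c)\<inverse> `` {y}. (\<lambda>p. p @ [(k, y)]) ` paths W c x k). path_value W p) =
      (\<Sum>k\<in>(arrows W c)\<inverse> `` {y}. \<Sum>p\<in>(\<lambda>p. p @ [(k, y)]) ` paths W c x k. path_value W p)"
    by (rule sum.UNION_disjoint) (use finite_predecessors finite_paths in auto)
  also have "\<dots> = (\<Sum>k\<in>(arrows W c)\<inverse> `` {y}. - gram (rho W y) (rho W k) * path_sum x k)"
  proof (rule sum.cong)
    fix k assume "k \<in> (arrows W c)\<inverse> `` {y}"
    moreover have "inj_on (\<lambda>p. p @ [(k, y)]) (paths W c x k)"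
      by (auto simp: inj_on_def)
    ultimately show "(\<Sum>p\<in>(\<lambda>p. p @ [(k, y)]) ` paths W c x k. path_value W p) =
        - gram (rho W y) (rho W k) * path_sum x k"
      by (simp add: sum.reindex path_sum_def sum_distrib_left sum_negf path_value_snoc)
  qed simp
  finally show ?thesis
    by (simp add: path_value_def)
qed

lemma path_sum_unreachable: "(x, y) \<notin> (arrows W c)\<^sup>* \<Longrightarrow> path_sum x y = 0"
  using is_path_rtrancl[of "arrows W c" x _ y] by (auto simp: path_sum_def paths_def intro: sum.neutral)

lemma path_sum_self: "path_sum x x = 1"
proof -
  have "path_sum x k = 0" if "(k, x) \<in> arrows W c" for k
    using that wf_acyclic[OF wf_arrows] path_sum_unreachable[of x k]
    by (auto simp: acyclic_def dest: rtrancl_into_trancl1)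
  then show ?thesis
    using path_sum_rec[of x x] by simp
qed

text \<open>The head \<open>z\<close> of the list acts last, when the coordinates of all later
  letters are final. The set \<open>D\<close> stands for the letters preceding the list in a longer
  sequence and contains all targets of arrows out of \<open>z\<close>.\<close>

lemma opr_topological:
  assumes "topological_from (arrows W c) D (ys @ [x])" "arrows W c `` D \<subseteq> D"
    and "set ys \<subseteq> verts W" "x \<in> verts W" "y \<in> verts W"
  shows "vopr ys (alpha (rho W x)) (rho W y) = (if y \<in> set (ys @ [x]) then path_sum x y else 0)"
  using assms
proof (induction ys arbitrary: D y)
  case Nil
  then show ?case
    by (auto simp: alpha_apply path_sum_self)
next
  case (Cons z ys)
  let ?A = "arrows W c" and ?v = "vopr ys (alpha (rho W x))"
  have top: "topological_from ?A (insert z D) (ys @ [x])" and zD: "z \<notin> D" "?A `` {z} \<subseteq> D"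
    and z: "z \<in> verts W"
    using Cons.prems by auto
  have closed: "?A `` insert z D \<subseteq> insert z D"
    using zD Cons.prems(2) by auto
  have v: "?v (rho W k) = (if k \<in> set (ys @ [x]) then path_sum x k else 0)" if "k \<in> verts W" for k
    using Cons.prems that by (intro Cons.IH[OF top closed]) auto
  have disj: "set (ys @ [x]) \<inter> insert z D = {}"
    using topological_from_distinct[OF top] by simp
  have closed': "?A `` (insert z D \<union> set (ys @ [x])) \<subseteq> insert z D \<union> set (ys @ [x])"
    using top closed by (rule topological_from_closed)
  show ?case
  proof (cases "y = z")
    case False
    then show ?thesis
      using v[OF Cons.prems(5)] Cons.prems(5) z by (simp add: reflection_apply)
  next
    case True
    have summand: "gram (rho W z) (rho W k) * ?v (rho W k) =
      (if k \<in> ?A\<inverse> `` {z} then gram (rho W z) (rho W k) * path_sum x k else 0)" if k: "k \<in> verts W" for k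
    proof (cases "(k, z) \<in> ?A")
      case True
      \<comment> \<open>The list together with \<open>z\<close> and \<open>D\<close> is closed under
        arrows, and no arrow from \<open>z\<close> or \<open>D\<close> ends in \<open>z\<close>. So
        a predecessor of \<open>z\<close> outside the list is unreachable from
        \<open>x\<close>.\<close>
      have "path_sum x k = 0" if "k \<notin> set (ys @ [x])"
      proof (rule path_sum_unreachable, rule notI)
        assume "(x, k) \<in> ?A\<^sup>*"
        then have "k \<in> insert z D \<union> set (ys @ [x])"
          using Image_closed_trancl[OF closed'] by auto
        then show False
          using True that zD Cons.prems(2) arrows_irrefl by auto
      qed
      then show ?thesis
        using v[OF k] True by simp
    next
      case False
      \<comment> \<open>Arrows out of \<open>z\<close> end in \<open>D\<close>, where the vector
        vanishes; only incoming arrows contribute.\<close>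
      have "(z, k) \<notin> ?A" if "k \<in> set (ys @ [x])"
        using that disj zD by auto
      then have "gram (rho W z) (rho W k) = 0" if "k \<in> set (ys @ [x])"
        using that disj False arrows_symclosure gram_edges[OF z k] by auto
      then show ?thesis
        using v[OF k] False by simp
    qed
    have "pairing (rho W z) ?v = (\<Sum>k\<in>verts W. gram (rho W z) (rho W k) * ?v (rho W k))"
      unfolding pairing_def by (rule sum.reindex_bij_betw[OF bij_rho, symmetric])
    also have "\<dots> = (\<Sum>k\<in>verts W. if k \<in> ?A\<inverse> `` {z} then gram (rho W z) (rho W k) * path_sum x k else 0)"
      using summand by (rule sum.cong[OF HOL.refl])
    also have "\<dots> = (\<Sum>k\<in>verts W \<inter> ?A\<inverse> `` {z}. gram (rho W z) (rho W k) * path_sum x k)"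
      using finite_verts by (rule sum.inter_restrict[symmetric])
    also have "verts W \<inter> ?A\<inverse> `` {z} = ?A\<inverse> `` {z}"
      by (auto dest: arrows_verts)
    finally have "path_sum x z = - pairing (rho W z) ?v"
      using path_sum_rec[of x z] disj by (auto simp: sum_negf)
    then show ?thesis
      using True v[OF z] z disj by (auto simp: reflection_apply)
  qed
qed

lemma vertex_le_iff: "x \<in> verts W \<Longrightarrow> vertex_le W c x y \<longleftrightarrow> (x, y) \<in> (arrows W c)\<^sup>*"
  using arrows_rtrancl_verts by (auto simp: vertex_le_def)

lemma opr_topological_eq:
  assumes "topological_from (arrows W c) {} (ys @ [x])" "set ys \<subseteq> verts W" "x \<in> verts W"
  shows "vopr ys (alpha (rho W x)) =
    (\<lambda>t. \<Sum>y | y \<in> verts W \<and> vertex_le W c x y. path_sum x y * alpha (rho W y) t)"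
proof
  fix t
  have closed: "arrows W c `` set (ys @ [x]) \<subseteq> set (ys @ [x])"
    using topological_from_closed[OF assms(1)] by simp
  show "vopr ys (alpha (rho W x)) t = (\<Sum>y | y \<in> verts W \<and> vertex_le W c x y. path_sum x y * alpha (rho W y) t)"
  proof (cases "t \<in> gens W")
    case True
    then obtain y where y: "y \<in> verts W" "t = rho W y"
      using bij_rho by (auto simp: bij_betw_def)
    have "(\<Sum>z | z \<in> verts W \<and> vertex_le W c x z. path_sum x z * alpha (rho W z) t) =
        (\<Sum>z | z \<in> verts W \<and> vertex_le W c x z. if z = y then path_sum x y else 0)"
      using y by (intro sum.cong) (auto simp: alpha_apply)
    also have "\<dots> = path_sum x y"
      using y finite_verts path_sum_unreachable vertex_le_iff[OF assms(3)] by (auto simp: sum.delta)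
    also have "\<dots> = vopr ys (alpha (rho W x)) t"
    proof -
      have "path_sum x y = 0" if "y \<notin> set (ys @ [x])"
        using that Image_closed_trancl[OF closed] by (intro path_sum_unreachable) auto
      then show ?thesis
        using opr_topological[OF assms(1) _ assms(2,3) y(1)] y(2) by simp
    qed
    finally show ?thesis
      by simp
  next
    case False
    then have "t \<notin> set (map (rho W) ys)" "\<And>y. y \<in> verts W \<Longrightarrow> t \<noteq> rho W y"
      using assms(2) by auto
    then show ?thesis
      using opr_outside[OF map_rho_subset[OF assms(2)], of t] assms(3) by (auto simp: alpha_apply intro!: sum.neutral)
  qed
qed

text \<open>For existence, \<open>vs\<close> is restricted to the up-set. For uniqueness, a
  competitor has the same letters, so by \<open>sink_sequence_prefix\<close> it is a left multiple,
  and equal lengths leave no extra factor.\<close>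

lemma W1_word:
  assumes "x \<in> verts W"
  obtains ys where "topological_from (arrows W c) {} (ys @ [x])" "set (ys @ [x]) = up_set W c x"
    "set ys \<subseteq> verts W" "W1 W c x = word_class W (rev (ys @ [x]))"
    "W1 W c x \<in> admissible W c" "mult_free (W1 W c x)"
proof -
  let ?A = "arrows W c" and ?P = "\<lambda>y. vertex_le W c x y"
  obtain as bs where vs: "vs = as @ x # bs"
    using assms set_vs by (metis split_list)
  define ys where "ys = filter ?P (rev bs)"
  have Px: "?P x"
    using assms by (simp add: vertex_le_def)
  have eq: "ys @ [x] = filter ?P (rev bs @ [x])"
    using Px by (simp add: ys_def)
  have up: "?A `` {z} \<subseteq> Collect ?P" if "?P z" for z
    using that arrows_verts by (auto simp: vertex_le_def intro: rtrancl_into_rtrancl)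
  have top: "topological_from ?A {} (ys @ [x])"
    using topological_from_filter[OF topological_split[OF vs] up] eq by simp
  have sub: "set ys \<subseteq> verts W"
    using set_vs vs by (auto simp: ys_def)
  have closed: "?A `` set (ys @ [x]) \<subseteq> set (ys @ [x])"
    using topological_from_closed[OF top] by simp
  have sets: "set (ys @ [x]) = up_set W c x"
  proof
    show "set (ys @ [x]) \<subseteq> up_set W c x"
      using Px by (auto simp: ys_def up_set_def)
    show "up_set W c x \<subseteq> set (ys @ [x])"
      using Image_closed_trancl[OF closed] by (auto simp: up_set_def vertex_le_def)
  qed
  let ?X = "word_class W (rev (ys @ [x]))"
  have lists: "rev (ys @ [x]) \<in> lists (verts W)"
    using sub assms by auto
  have sinks: "sink_sequence ?A (ys @ [x])" "distinct (ys @ [x])"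
    using top sink_sequence_distinct_iff by blast+
  have X: "?X \<in> admissible W c" "mult_free ?X" "Supp ?X = up_set W c x"
    using lists sinks sets by (auto simp: admissible_def admissible_word_def mult_free_word_class Supp_word_class)
  have "Y = ?X" if Y: "Y \<in> admissible W c" "mult_free Y" "Supp Y = up_set W c x" for Y
  proof -
    obtain u where u: "Y = word_class W u" "u \<in> lists (verts W)" "sink_sequence ?A (rev u)"
      using Y(1) by (auto simp: admissible_def admissible_word_def)
    have du: "distinct u" "set u = set (ys @ [x])"
      using Y(2,3) u(1) sets mult_free_word_class[OF u(2)] Supp_word_class[OF u(2)] by blast+
    obtain w where w: "(u, w @ rev (ys @ [x])) \<in> graph_cong W"
      using sink_sequence_prefix[OF arrows_symclosure u(3) _ sinks] u(2) du(2) by auto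
    have "length u = length (ys @ [x])"
      using du sinks(2) by (metis distinct_card)
    then have "w = []"
      using graph_cong_mset[OF w, THEN arg_cong, of size] by simp
    then show ?thesis
      using w u(1,2) lists by (simp add: word_class_eq_iff)
  qed
  then have "W1 W c x = ?X"
    unfolding W1_def by (intro the_equality conjI X) blast
  then show ?thesis
    using that[OF top sets sub] X by metis
qed

lemma pi_root_def':
  assumes "x \<in> verts W"
  shows "pi_root W c (rho W x) = act W (rho_monoid W (word_transp (W1 W c x))) (- alpha (rho W x))"
  using assms inj_rho by (simp add: pi_root_def the_inv_into_f_f)

text \<open>In the transposed word \<open>x\<close> acts first and turns
  \<open>- alpha (rho W x)\<close> into the simple root.\<close>

lemma pi_root_eq_W1:
  assumes "W1 W c x = word_class W (rev (ys @ [x]))" "set ys \<subseteq> verts W" "x \<in> verts W"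
  shows "pi_root W c (rho W x) = vopr ys (alpha (rho W x))"
proof -
  have "rev (ys @ [x]) \<in> lists (verts W)" "ys @ [x] \<in> lists (verts W)"
    using assms by auto
  then have "pi_root W c (rho W x) = vopr (ys @ [x]) (- alpha (rho W x))"
    using assms by (simp only: pi_root_def' word_transp_word_class rev_rev_ident act_rho_monoid)
  also have "\<dots> = vopr ys (reflection W (rho W x) (reflection W (rho W x) (alpha (rho W x))))"
    using assms by (simp add: reflection_alpha_self)
  finally show ?thesis
    using assms by simp
qed

lemma pi_root_formula:
  assumes "x \<in> verts W"
  shows "pi_root W c (rho W x) =
    (\<lambda>t. \<Sum>y | y \<in> verts W \<and> vertex_le W c x y. path_sum x y * alpha (rho W y) t)"
proof (rule W1_word[OF assms])
  fix ys
  assume "topological_from (arrows W c) {} (ys @ [x])" "set ys \<subseteq> verts W"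
    and "W1 W c x = word_class W (rev (ys @ [x]))"
  then show ?thesis
    using pi_root_eq_W1 opr_topological_eq assms by simp
qed

lemma pi_root_eq:
  assumes "topological_from (arrows W c) {} (ys @ [x])" "set ys \<subseteq> verts W" "x \<in> verts W"
  shows "pi_root W c (rho W x) = vopr ys (alpha (rho W x))"
  using pi_root_formula opr_topological_eq assms by simp

lemma pi_root_coordinate:
  assumes "x \<in> verts W" "y \<in> verts W"
  shows "pi_root W c (rho W x) (rho W y) = path_sum x y"
proof -
  have "pi_root W c (rho W x) (rho W y) = (\<Sum>z | z \<in> verts W \<and> vertex_le W c x z. if z = y then path_sum x y else 0)"
    unfolding pi_root_formula[OF assms(1)] using assms(2) by (intro sum.cong) (auto simp: alpha_apply)
  then show ?thesis
    using assms finite_verts path_sum_unreachable vertex_le_iff by (auto simp: sum.delta)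
qed

end

section \<open>Projective roots\<close>

lemma uminus_uminus_fun: "- (- v) = (v :: 'a \<Rightarrow> real)"
  by (simp add: fun_eq_iff)

context ordered_coxeter
begin

lemma roots_eq: "roots W = {opr u (alpha s) | u s. u \<in> lists (gens W) \<and> s \<in> gens W}"
proof (intro equalityI subsetI)
  fix v assume "v \<in> roots W"
  then obtain w s where v: "v = act W w (alpha s)" "w \<in> carrier W" "s \<in> gens W"
    by (auto simp: roots_def)
  then obtain u where u: "u \<in> lists (gens W)" "word_prod W u = w"
    using system unfolding coxeter_system_def by blast
  then have "v = opr u (alpha s)"
    using v(1) act_word_prod[of u] by simp
  then show "v \<in> {opr u (alpha s) | u s. u \<in> lists (gens W) \<and> s \<in> gens W}"
    using u(1) v(3) by blast
next
  fix v assume "v \<in> {opr u (alpha s) | u s. u \<in> lists (gens W) \<and> s \<in> gens W}"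
  then obtain u s where u: "v = opr u (alpha s)" "u \<in> lists (gens W)" "s \<in> gens W"
    by blast
  then have "v = act W (word_prod W u) (alpha s)" "word_prod W u \<in> carrier W"
    by (simp_all add: act_word_prod)
  then show "v \<in> roots W"
    using u(3) unfolding roots_def by blast
qed

lemma vopr_root: "v \<in> roots W \<Longrightarrow> u \<in> lists (verts W) \<Longrightarrow> vopr u v \<in> roots W"
proof -
  assume "v \<in> roots W" "u \<in> lists (verts W)"
  then obtain w s where w: "v = opr w (alpha s)" "w \<in> lists (gens W)" "s \<in> gens W"
    by (auto simp: roots_eq)
  then have "vopr u v = opr (map (rho W) u @ w) (alpha s)" "map (rho W) u @ w \<in> lists (gens W)"
    using \<open>u \<in> lists (verts W)\<close> by auto
  then show ?thesis
    using w(3) unfolding roots_eq by blast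
qed

lemma alpha_root: "x \<in> verts W \<Longrightarrow> alpha (rho W x) \<in> roots W"
  unfolding roots_eq by (auto intro!: exI[of _ "[]"] exI[of _ "rho W x"])

text \<open>The sign predicates look only at coordinates in \<open>gens W\<close>; with this, sign
  statements about roots may range over all coordinates.\<close>

lemma root_outside: "v \<in> roots W \<Longrightarrow> t \<notin> gens W \<Longrightarrow> v t = 0"
proof -
  assume "v \<in> roots W" and t: "t \<notin> gens W"
  then obtain u s where u: "v = opr u (alpha s)" "set u \<subseteq> gens W" "s \<in> gens W"
    by (auto simp: roots_eq in_lists_conv_set)
  then have "t \<notin> set u" "t \<noteq> s"
    using t by blast+
  then show ?thesis
    using opr_outside[OF u(2), of t "alpha s"] u(1) by (simp add: alpha_apply)
qed

lemma root_sq_norm: "v \<in> roots W \<Longrightarrow> sq_norm v = 2"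
proof -
  assume "v \<in> roots W"
  then obtain u s where "v = opr u (alpha s)" "set u \<subseteq> gens W" "s \<in> gens W"
    by (auto simp: roots_eq in_lists_conv_set)
  then show ?thesis
    using sq_norm_opr sq_norm_scaled_alpha[of s 1] by simp
qed

lemma root_sign: "v \<in> roots W \<Longrightarrow> (\<forall>t. 0 \<le> v t) \<or> (\<forall>t. v t \<le> 0)"
  using opr_alpha_sign by (auto simp: roots_eq)

lemma root_nonzero: "v \<in> roots W \<Longrightarrow> \<exists>t. v t \<noteq> 0"
proof (rule ccontr)
  assume "v \<in> roots W" "\<not> (\<exists>t. v t \<noteq> 0)"
  then have "sq_norm v = 0"
    by (simp add: sq_norm_def)
  then show False
    using root_sq_norm[OF \<open>v \<in> roots W\<close>] by simp
qed

lemma pi_root_pos: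
  assumes "x \<in> verts W"
  shows "pos_root W (pi_root W c (rho W x))"
proof -
  obtain ys where ys: "topological_from (arrows W c) {} (ys @ [x])" "set ys \<subseteq> verts W"
    using W1_word[OF assms] by metis
  have eq: "pi_root W c (rho W x) = vopr ys (alpha (rho W x))"
    using pi_root_eq[OF ys assms] .
  have "distinct (map (rho W) ys)" "rho W x \<notin> set (map (rho W) ys)"
    using topological_from_distinct[OF ys(1)] ys(2) assms inj_rho
    by (auto simp: distinct_map intro: inj_on_subset)
  then have "0 \<le> pi_root W c (rho W x) t" for t
    unfolding eq using opr_alpha_distinct(1)[OF rho_gens[OF assms] map_rho_subset[OF ys(2)]] by simp
  moreover have "ys \<in> lists (verts W)"
    using ys(2) by auto
  then have "pi_root W c (rho W x) \<in> roots W"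
    unfolding eq using vopr_root alpha_root[OF assms] by blast
  ultimately show ?thesis
    by (simp add: pos_root_def)
qed

lemma neg_alpha_root:
  assumes "x \<in> verts W"
  shows "neg_root W (- alpha (rho W x))"
proof -
  have "- alpha (rho W x) = vopr [x] (alpha (rho W x))"
    using assms by (simp add: reflection_alpha_self)
  moreover have "vopr [x] (alpha (rho W x)) \<in> roots W"
    using assms by (intro vopr_root alpha_root) auto
  ultimately have "- alpha (rho W x) \<in> roots W"
    by (simp only:)
  then show ?thesis
    by (simp add: neg_root_def alpha_apply)
qed

lemma W1_pi_root:
  assumes "x \<in> verts W"
  shows "act W (rho_monoid W (W1 W c x)) (pi_root W c (rho W x)) = - alpha (rho W x)"
proof (rule W1_word[OF assms])
  fix ys
  assume ys: "set ys \<subseteq> verts W" "W1 W c x = word_class W (rev (ys @ [x]))"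
  have "rev (ys @ [x]) \<in> lists (verts W)"
    using ys assms by auto
  then have "act W (rho_monoid W (W1 W c x)) = vopr (rev (ys @ [x]))"
    unfolding ys(2) by (rule act_rho_monoid)
  moreover have "opr (rev (map (rho W) ys)) (vopr ys v) = v" for v
    by (rule opr_rev_cancel[OF map_rho_subset[OF ys(1)]])
  ultimately show ?thesis
    using pi_root_eq_W1[OF ys(2,1) assms] assms by (simp add: rev_map reflection_alpha_self)
qed

lemma projective_pi_root:
  assumes "x \<in> verts W"
  shows "projective W c (pi_root W c (rho W x))"
  unfolding projective_def
  using pi_root_pos[OF assms] W1_pi_root[OF assms] neg_alpha_root[OF assms] W1_word[OF assms] by metis

text \<open>The coordinate of \<open>pi_root\<close> at \<open>rho x\<close> is \<open>1\<close>, and only the letter \<open>x\<close> can change it.\<close>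

lemma W1_preceq_negating:
  assumes "x \<in> verts W" "X \<in> negating W c (pi_root W c (rho W x))"
  shows "preceq W (W1 W c x) X"
proof (rule W1_word[OF assms(1)])
  fix ys
  assume ys: "topological_from (arrows W c) {} (ys @ [x])" "set (ys @ [x]) = up_set W c x"
    "W1 W c x = word_class W (rev (ys @ [x]))" "set ys \<subseteq> verts W"
  have "X \<in> admissible W c" and X: "neg_root W (act W (rho_monoid W X) (pi_root W c (rho W x)))"
    using assms(2) by (simp_all add: negating_def)
  then obtain u where u: "X = word_class W u" "u \<in> lists (verts W)" "sink_sequence (arrows W c) (rev u)"
    unfolding admissible_def admissible_word_def by blast
  have neg: "neg_root W (vopr u (pi_root W c (rho W x)))"
    using X unfolding u(1) act_rho_monoid[OF u(2)] .
  have "x \<in> set u"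
  proof (rule ccontr)
    assume "x \<notin> set u"
    then have "rho W x \<notin> set (map (rho W) u)"
      using u(2) assms(1) by auto
    then have "vopr u (pi_root W c (rho W x)) (rho W x) = 1"
      using opr_outside[of "map (rho W) u"] pi_root_coordinate[OF assms(1,1)] path_sum_self u(2) by (simp add: lists_eq_set)
    then show False
      using neg rho_gens[OF assms(1)] unfolding neg_root_def by (metis not_one_le_zero)
  qed
  \<comment> \<open>Once \<open>x\<close> occurs, the sink condition forces every vertex reachable
    from \<open>x\<close> to occur.\<close>
  have "y \<in> set u" if "(x, y) \<in> (arrows W c)\<^sup>*" for y
    using that
  proof (induction rule: rtrancl_induct)
    case (step y z)
    then show ?case
      using sink_sequence_closed[OF u(3), of y z] by simp
  qed (fact \<open>x \<in> set u\<close>)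
  then have sub: "set (ys @ [x]) \<subseteq> set (rev u)"
    unfolding ys(2) by (auto simp: up_set_def vertex_le_def)
  have "sink_sequence (arrows W c) (ys @ [x])" "distinct (ys @ [x])"
    using ys(1) sink_sequence_distinct_iff by blast+
  moreover have "set (rev u) \<subseteq> verts W"
    using u(2) by auto
  ultimately have "\<exists>w\<in>lists (verts W). (rev (rev u), w @ rev (ys @ [x])) \<in> graph_cong W"
    using sink_sequence_prefix[OF arrows_symclosure u(3)] sub by blast
  moreover have "rev (ys @ [x]) \<in> lists (verts W)"
    using ys(4) assms(1) by auto
  ultimately show ?thesis
    unfolding u(1) ys(3) using preceq_iff[OF u(2)] by simp
qed

lemma W_root_pi_root:
  assumes "x \<in> verts W"
  shows "W_root W c (pi_root W c (rho W x)) = W1 W c x"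
proof -
  let ?N = "negating W c (pi_root W c (rho W x))"
  have adm: "W1 W c x \<in> admissible W c"
    using W1_word[OF assms] by metis
  have mem: "W1 W c x \<in> ?N"
    using adm W1_pi_root[OF assms] neg_alpha_root[OF assms] by (simp add: negating_def)
  have word: "\<exists>u\<in>lists (verts W). X = word_class W u" if "X \<in> ?N" for X
    using that by (auto simp: negating_def admissible_def admissible_word_def)
  show ?thesis
    unfolding W_root_def
  proof (rule the_equality)
    show "W1 W c x \<in> ?N \<and> (\<forall>Y\<in>?N. preceq W (W1 W c x) Y)"
      using mem W1_preceq_negating[OF assms] by blast
    fix X assume X: "X \<in> ?N \<and> (\<forall>Y\<in>?N. preceq W X Y)"
    then have "preceq W X (W1 W c x)" "preceq W (W1 W c x) X"
      using mem W1_preceq_negating[OF assms] by blast+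
    then show "X = W1 W c x"
      using word[OF mem] word[of X] X preceq_antisym by metis
  qed
qed

text \<open>Since a root has constant sign and norm \<open>2\<close>, a positive root made negative by a simple
  reflection is the corresponding simple root.\<close>

lemma simple_root_of_sign_change:
  assumes "v \<in> roots W" "x \<in> verts W" "\<And>t. 0 \<le> v t" "\<And>t. reflection W (rho W x) v t \<le> 0"
  shows "v = alpha (rho W x)"
proof -
  \<comment> \<open>The other coordinates are not changed by the reflection, so they are both
    nonnegative and nonpositive.\<close>
  have v: "v = (\<lambda>t. v (rho W x) * alpha (rho W x) t)"
  proof
    fix t show "v t = v (rho W x) * alpha (rho W x) t"
      using assms(3,4)[of t] assms(2) by (auto simp: reflection_apply alpha_apply)
  qed
  have "2 * (v (rho W x))\<^sup>2 = 2"
    using sq_norm_scaled_alpha[of "rho W x" "v (rho W x)"] root_sq_norm[OF assms(1)] assms(2) v by simp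
  then have "v (rho W x) = 1"
    using assms(3)[of "rho W x"] by (simp add: power2_eq_1_iff)
  then show ?thesis
    using v by simp
qed

lemma projective_is_pi_root:
  assumes "projective W c a"
  shows "\<exists>x\<in>verts W. a = pi_root W c (rho W x)"
proof -
  obtain X where pos: "pos_root W a" and X: "X \<in> admissible W c" "mult_free X"
    "neg_root W (act W (rho_monoid W X) a)"
    using assms by (auto simp: projective_def)
  then obtain u where u: "u \<in> lists (verts W)" "sink_sequence (arrows W c) (rev u)" "distinct u"
    and Xu: "X = word_class W u"
    using mult_free_word_class unfolding admissible_def admissible_word_def by blast
  have neg: "neg_root W (vopr u a)"
    using X(3) unfolding Xu act_rho_monoid[OF u(1)] .
  \<comment> \<open>\<open>ps\<close> are the letters already applied, \<open>v\<close> is the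
    current, still nonnegative root, and \<open>zs\<close> are the letters to come.\<close>
  have step: "\<exists>as x bs. rev u = as @ x # bs \<and> vopr (rev as) a = alpha (rho W x)"
    if "set zs \<subseteq> verts W" "v \<in> roots W" "\<forall>t. 0 \<le> v t" "\<forall>t. vopr (rev zs) v t \<le> 0"
      "rev u = ps @ zs" "v = vopr (rev ps) a" for zs v ps
    using that
  proof (induction zs arbitrary: v ps)
    case Nil
    \<comment> \<open>Running out of letters would leave a root that is both nonnegative and
      nonpositive, hence 0.\<close>
    then show ?case
      using root_nonzero[of v] by (metis foldr.simps(1) id_apply list.simps(8) order_antisym rev.simps(1))
  next
    case (Cons z zs)
    let ?w = "reflection W (rho W z) v"
    have z: "z \<in> verts W"
      using Cons.prems(1) by simp
    have w: "?w \<in> roots W"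
      using vopr_root[OF Cons.prems(2), of "[z]"] z by simp
    show ?case
    proof (cases "\<forall>t. 0 \<le> ?w t")
      case True
      then show ?thesis
        using Cons.prems w by (intro Cons.IH[of ?w "ps @ [z]"]) auto
    next
      case False
      then have "\<forall>t. ?w t \<le> 0"
        using root_sign[OF w] by blast
      then have "v = alpha (rho W z)"
        using Cons.prems(2,3) z by (intro simple_root_of_sign_change) auto
      then have "vopr (rev ps) a = alpha (rho W z)"
        using Cons.prems(6) by simp
      then show ?thesis
        using Cons.prems(5) by blast
    qed
  qed
  have "\<forall>t. 0 \<le> a t" "\<forall>t. vopr u a t \<le> 0"
    using pos neg root_outside[of a] root_outside[of "vopr u a"]
    by (metis order_refl pos_root_def, metis order_refl neg_root_def)
  moreover have "set (rev u) \<subseteq> verts W" "a \<in> roots W"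
    using u(1) pos by (auto simp: pos_root_def)
  ultimately have "\<exists>as x bs. rev u = as @ x # bs \<and> vopr (rev as) a = alpha (rho W x)"
    using step[of "rev u" a "[]"] by simp
  then obtain as x bs where split: "rev u = as @ x # bs" and a: "vopr (rev as) a = alpha (rho W x)"
    by blast
  have "topological_from (arrows W c) {} (rev u)"
    using u(2,3) sink_sequence_distinct_iff[of "arrows W c" "rev u"] by simp
  then have "topological_from (arrows W c) {} ((as @ [x]) @ bs)"
    unfolding split by simp
  \<comment> \<open>An initial part of a repetition-free admissible sequence is again one, so
    \<open>pi_root_eq\<close> applies to the letters up to \<open>x\<close>.\<close>
  then have top: "topological_from (arrows W c) {} (as @ [x])"
    unfolding topological_from_append[of _ _ "as @ [x]"] by blast
  have "set (as @ [x]) \<subseteq> set u"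
    using split by (metis append.assoc append_Cons append_Nil set_append set_rev sup_ge1)
  then have sub: "set as \<subseteq> verts W" "x \<in> verts W"
    using u(1) by auto
  have "vopr as (vopr (rev as) a) = a"
    using opr_rev_cancel'[of "map (rho W) as"] sub(1) by (simp add: rev_map)
  then have "a = pi_root W c (rho W x)"
    using pi_root_eq[OF top sub] a by simp
  then show ?thesis
    using sub(2) by blast
qed

lemma proj_roots_eq: "proj_roots W c = pi_root W c ` gens W"
proof -
  have "projective W c a \<longleftrightarrow> (\<exists>x\<in>verts W. a = pi_root W c (rho W x))" for a
    using projective_pi_root projective_is_pi_root[of a] by auto
  then have "proj_roots W c = {a. \<exists>x\<in>verts W. a = pi_root W c (rho W x)}"
    by (simp add: proj_roots_def)
  also have "\<dots> = pi_root W c ` gens W"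
    unfolding rho_image[symmetric] by blast
  finally show ?thesis .
qed

text \<open>If the roots of \<open>x\<close> and \<open>y\<close> agree, comparing their coordinates
  at \<open>x\<close> and at \<open>y\<close> gives path sums 1 in both directions, hence paths both
  ways, which acyclicity excludes unless \<open>x = y\<close>.\<close>

lemma inj_pi_root: "inj_on (pi_root W c) (gens W)"
proof (rule inj_onI)
  fix r s assume rs: "r \<in> gens W" "s \<in> gens W" "pi_root W c r = pi_root W c s"
  then obtain x y where xy: "x \<in> verts W" "y \<in> verts W" "r = rho W x" "s = rho W y"
    using rho_image by blast
  have "path_sum x y = 1" "path_sum y x = 1"
    using pi_root_coordinate[OF xy(2,2)] pi_root_coordinate[OF xy(1,1)] pi_root_coordinate[OF xy(1,2)]
      pi_root_coordinate[OF xy(2,1)] rs(3) path_sum_self by (simp_all add: xy)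
  then have "(x, y) \<in> (arrows W c)\<^sup>*" "(y, x) \<in> (arrows W c)\<^sup>*"
    using path_sum_unreachable[of x y] path_sum_unreachable[of y x] by auto
  then have "x = y"
    using acyclic_impl_antisym_rtrancl[OF wf_acyclic[OF wf_arrows]] by (auto dest: antisymD)
  then show "r = s"
    by (simp add: xy)
qed

section \<open>The inverse Coxeter element\<close>

lemma inverse_ordered: "ordered_coxeter W (inv\<^bsub>W\<^esub> c) (rev vs)"
proof
  show "word_prod W (map (rho W) (rev vs)) = inv\<^bsub>W\<^esub> c"
    using inv_word_prod[of "map (rho W) vs"] c_eq by (simp add: rev_map)
qed (use distinct_vs set_vs in auto)

text \<open>Write \<open>vs = as @ x # bs\<close>. When \<open>c\<close> is applied to the root,
  \<open>bs\<close> cancels \<open>rev bs\<close>, then \<open>x\<close> negates the simple root,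
  and \<open>as\<close> produces the root for the inverse.\<close>

lemma pi_root_inverse:
  assumes "s \<in> gens W"
  shows "pi_root W (inv\<^bsub>W\<^esub> c) s = - act W c (pi_root W c s)"
proof -
  interpret rev: ordered_coxeter W "inv\<^bsub>W\<^esub> c" "rev vs"
    by (rule inverse_ordered)
  obtain x where x: "x \<in> verts W" "s = rho W x"
    using assms bij_rho by (auto simp: bij_betw_def)
  then obtain as bs where vs: "vs = as @ x # bs"
    using set_vs by (metis split_list)
  have sub: "set as \<subseteq> verts W" "set (rev bs) \<subseteq> verts W" "set bs \<subseteq> verts W"
    using vs set_vs by auto
  have "pi_root W c s = vopr (rev bs) (alpha s)"
    using pi_root_eq[OF topological_split[OF vs] sub(2) x(1)] x(2) by simp
  moreover have "pi_root W (inv\<^bsub>W\<^esub> c) s = vopr as (alpha s)"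
    using rev.pi_root_eq[OF rev.topological_split[of "rev bs" x "rev as"] _ x(1)] vs sub(1) x(2) by simp
  moreover have "vopr bs (vopr (rev bs) v) = v" for v
    using opr_rev_cancel'[of "map (rho W) bs"] sub(3) by (simp add: rev_map)
  ultimately show ?thesis
    using x sub(1) by (simp add: act_c vs reflection_alpha_self opr_uminus uminus_uminus_fun)
qed

lemma act_inverse_cancel: "act W (inv\<^bsub>W\<^esub> c) (- act W c v) = - v"
proof -
  interpret rev: ordered_coxeter W "inv\<^bsub>W\<^esub> c" "rev vs"
    by (rule inverse_ordered)
  have "set (map (rho W) vs) \<subseteq> gens W"
    using set_vs by simp
  then have "opr (rev (map (rho W) vs)) (- vopr vs v) = - v"
    using opr_rev_cancel[of "map (rho W) vs" v] opr_uminus[of "rev (map (rho W) vs)"] by simp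
  then show ?thesis
    by (simp add: act_c rev.act_c rev_map)
qed

end

theorem theorem2p6:
  fixes W :: "('w, 'v) coxeter_data" and c s :: 'w and x :: 'v
  assumes "coxeter_system W"
    and "finite (gens W)"
    and "bij_betw (rho W) (verts W) (gens W)"
    and "irreducible_graph W"
    and "coxeter_element W c"
    and "s \<in> gens W" and "x \<in> verts W" and "s = rho W x"
  shows
    "(pi_root W c s = act W (rho_monoid W (word_transp (W1 W c x))) (- alpha s) \<and>
      projective W c (pi_root W c s) \<and>
      W_root W c (pi_root W c s) = W1 W c x \<and>
      bij_betw (pi_root W c) (gens W) (proj_roots W c) \<and>
      proj_roots W c = {pi_root W c r | r. r \<in> gens W}) \<and>
     ((\<forall>y\<in>verts W.
        (\<not> vertex_le W c x y \<longrightarrow> pi_root W c s (rho W y) = 0) \<and>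
        (vertex_le W c x y \<longrightarrow> pi_root W c s (rho W y) = (\<Sum>p\<in>paths W c x y. path_value W p))) \<and>
      pi_root W c s = (\<lambda>t. \<Sum>y | y \<in> verts W \<and> vertex_le W c x y.
        (\<Sum>p\<in>paths W c x y. path_value W p) * alpha (rho W y) t)) \<and>
     (pi_root W c s = - act W (inv\<^bsub>W\<^esub> c) (pi_root W (inv\<^bsub>W\<^esub> c) s) \<and>
      pi_root W (inv\<^bsub>W\<^esub> c) s = - act W c (pi_root W c s) \<and>
      bij_betw (\<lambda>v. - act W c v) (proj_roots W c) (proj_roots W (inv\<^bsub>W\<^esub> c)) \<and>
      bij_betw (\<lambda>v. - act W (inv\<^bsub>W\<^esub> c) v) (proj_roots W (inv\<^bsub>W\<^esub> c)) (proj_roots W c) \<and>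
      (\<forall>v\<in>proj_roots W c. - act W (inv\<^bsub>W\<^esub> c) (- act W c v) = v) \<and>
      (\<forall>v\<in>proj_roots W (inv\<^bsub>W\<^esub> c). - act W c (- act W (inv\<^bsub>W\<^esub> c) v) = v))"
proof -
  interpret labelled_coxeter W
    using assms by unfold_locales auto
  obtain ss where ss: "distinct ss" "set ss = gens W" "word_prod W ss = c"
    using assms(5) by (auto simp: coxeter_element_def cox_ordering_def)
  define vs where "vs = map (the_inv_into (verts W) (rho W)) ss"
  have bij: "bij_betw (the_inv_into (verts W) (rho W)) (gens W) (verts W)"
    using bij_rho by (rule bij_betw_the_inv_into)
  have "map (rho W) vs = ss"
    unfolding vs_def map_map
    using ss(2) bij_rho by (intro map_idI) (auto simp: bij_betw_def f_the_inv_into_f)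
  moreover have "distinct vs" "set vs = verts W"
    using ss(1,2) bij by (auto simp: vs_def distinct_map bij_betw_def)
  ultimately interpret ordered_coxeter W c vs
    using ss(3) by unfold_locales auto
  interpret rev: ordered_coxeter W "inv\<^bsub>W\<^esub> c" "rev vs"
    by (rule inverse_ordered)
  \<comment> \<open>Results for the reversed ordering mention the inverse of the inverse of
    \<open>c\<close>; this brings them back to \<open>c\<close>.\<close>
  have inv_inv: "inv\<^bsub>W\<^esub> (inv\<^bsub>W\<^esub> c) = c"
    using group.inv_inv[OF group_W, of c] c_eq word_prod_closed[of "map (rho W) vs"] by simp
  have c1: "- act W (inv\<^bsub>W\<^esub> c) (- act W c v) = v" for v
    by (simp add: act_inverse_cancel uminus_uminus_fun)
  have c2: "- act W c (- act W (inv\<^bsub>W\<^esub> c) v) = v" for v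
    using rev.act_inverse_cancel[of v] by (simp add: inv_inv uminus_uminus_fun)
  have pi1: "pi_root W (inv\<^bsub>W\<^esub> c) r = - act W c (pi_root W c r)"
    and pi2: "pi_root W c r = - act W (inv\<^bsub>W\<^esub> c) (pi_root W (inv\<^bsub>W\<^esub> c) r)" if "r \<in> gens W" for r
    using pi_root_inverse[OF that] rev.pi_root_inverse[OF that] by (simp_all only: inv_inv)
  have im: "(\<lambda>v. - act W c v) ` proj_roots W c = proj_roots W (inv\<^bsub>W\<^esub> c)"
    unfolding proj_roots_eq rev.proj_roots_eq image_image using pi1 by simp
  have im': "(\<lambda>v. - act W (inv\<^bsub>W\<^esub> c) v) ` proj_roots W (inv\<^bsub>W\<^esub> c) = proj_roots W c"
    unfolding proj_roots_eq rev.proj_roots_eq image_image using pi2 by simp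
  have bij_c: "bij_betw (\<lambda>v. - act W c v) (proj_roots W c) (proj_roots W (inv\<^bsub>W\<^esub> c))"
    by (rule bij_betw_byWitness[where f' = "\<lambda>v. - act W (inv\<^bsub>W\<^esub> c) v"])
      (simp_all add: c1 c2 im im')
  have bij_c': "bij_betw (\<lambda>v. - act W (inv\<^bsub>W\<^esub> c) v) (proj_roots W (inv\<^bsub>W\<^esub> c)) (proj_roots W c)"
    by (rule bij_betw_byWitness[where f' = "\<lambda>v. - act W c v"])
      (simp_all add: c1 c2 im im')
  have bij_pi: "bij_betw (pi_root W c) (gens W) (proj_roots W c)"
    using inj_pi_root proj_roots_eq by (simp add: bij_betw_def)
  have proj: "proj_roots W c = {pi_root W c r | r. r \<in> gens W}"
    unfolding proj_roots_eq by blast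
  have zero: "pi_root W c (rho W x) (rho W y) = 0" if "y \<in> verts W" "\<not> vertex_le W c x y" for y
    using that path_sum_unreachable vertex_le_iff[OF assms(7)] pi_root_coordinate[OF assms(7)] by simp
  note facts = pi_root_def'[OF assms(7)] projective_pi_root[OF assms(7)] W_root_pi_root[OF assms(7)]
    bij_pi proj zero pi_root_coordinate[OF assms(7), unfolded path_sum_def]
    pi_root_formula[OF assms(7), unfolded path_sum_def] pi2[OF rho_gens[OF assms(7)]]
    pi1[OF rho_gens[OF assms(7)]] bij_c bij_c' c1 c2
  show ?thesis
    unfolding assms(8) by (intro conjI ballI impI; rule facts; assumption?)
qed

end
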